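(* Let $M$ be an $n$-dimensional manifold, $n>2$, $(g,\xi:=grad(f),\lambda,\mu)$ a gradient $\eta$-Ricci soliton on $M$ with $\eta=df$ the $g$-dual $1$-form of $\xi$, and $\gamma$ a $1$-form on $M$. 1. If $\gamma$ is orthogonal to $\eta$, then $\langle Hess(f),\nabla\gamma\rangle=-\tfrac12\langle df,\Delta(\gamma)\rangle$. 2. If $\gamma$ is harmonic, then $\tfrac12\Delta(\langle df,\gamma\rangle)=\langle Hess(f),\nabla\gamma\rangle-\mu\,\Delta(f)\langle df,\gamma\rangle$. In this case, $\langle df,\gamma\rangle$ is harmonic if and only if $\mu\,\Delta(f)\langle df,\gamma\rangle=\langle Hess(f),\nabla\gamma\rangle$. Moreover, if (in addition to being harmonic) $\gamma$ is orthogonal to $\eta$, then $\nabla\gamma$ is orthogonal to $\nabla\eta$, i.e. $\langle\nabla\gamma,\nabla\eta\rangle=0$.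
   Context: $g$ is a Riemannian metric on $M$, $f\in C^\infty(M)$, $\nabla$ the Levi-Civita connection, $S$ the Ricci tensor. The gradient $\eta$-Ricci soliton condition is $L_{\xi}g+2S+2\lambda g+2\mu\,\eta\otimes\eta=0$ with $\xi=grad(f)$, $\eta=df$ (equivalently $Hess(f)+S+\lambda g+\mu\,df\otimes df=0$), $\lambda,\mu$ real constants. $\Delta$ is the Laplace-Hodge operator on forms with the sign for which $\Delta(u)=div(grad(u))$ on functions and $\Delta(du)=d(\Delta(u))$, i.e. $\Delta=-(d\delta+\delta d)$; a form or function is harmonic if $\Delta$ annihilates it. $\langle\gamma_1,\gamma_2\rangle=\sum_i\gamma_1(E_i)\gamma_2(E_i)$ for $1$-forms and $\langle T_1,T_2\rangle=\sum_{i,j}T_1(E_i,E_j)T_2(E_i,E_j)$ for $(0,2)$-tensor fields, with $\{E_i\}$ a local orthonormal frame; orthogonality means that this product vanishes. *)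

theory Defs
  imports "HOL-Analysis.Analysis"
begin

section \<open>Smooth manifolds\<close>

text \<open>Iterated continuous partial derivatives; only meaningful, and only used, on open sets.\<close>

primrec Ck_on :: "nat \<Rightarrow> (real^'n \<Rightarrow> real) \<Rightarrow> (real^'n) set \<Rightarrow> bool" where
  "Ck_on 0 h S \<longleftrightarrow> continuous_on S h"
| "Ck_on (Suc k) h S \<longleftrightarrow> h differentiable_on S \<and>
     (\<forall>i. Ck_on k (\<lambda>x. frechet_derivative h (at x) (axis i 1)) S)"

definition Cinf_on :: "(real^'n) set \<Rightarrow> (real^'n \<Rightarrow> real) \<Rightarrow> bool" where
  "Cinf_on S h \<longleftrightarrow> (\<forall>k. Ck_on k h S)"

text \<open>The manifold is the whole type \<open>'m\<close>; its dimension is \<open>CARD('n)\<close>. A chart is a domain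
  together with a coordinate map, which is irrelevant outside of the domain.\<close>

type_synonym ('m, 'n) chart = "'m set \<times> ('m \<Rightarrow> real^'n)"

definition smooth_manifold ::
  "('m::{t2_space,second_countable_topology}, 'n::finite) chart set \<Rightarrow> bool" where
  "smooth_manifold A \<longleftrightarrow>
     (\<forall>(U, \<phi>)\<in>A. open U \<and> open (\<phi> ` U) \<and> homeomorphism U (\<phi> ` U) \<phi> (inv_into U \<phi>)) \<and>
     (\<Union>(U, \<phi>)\<in>A. U) = UNIV \<and>
     (\<forall>(U, \<phi>)\<in>A. \<forall>(V, \<psi>)\<in>A. \<forall>i. Cinf_on (\<phi> ` (U \<inter> V)) (\<lambda>x. \<psi> (inv_into U \<phi> x) $ i))"

definition smooth_fun_on ::
  "('m::topological_space, 'n::finite) chart set \<Rightarrow> 'm set \<Rightarrow> ('m \<Rightarrow> real) \<Rightarrow> bool" where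
  "smooth_fun_on A W f \<longleftrightarrow>
     open W \<and> (\<forall>(U, \<phi>)\<in>A. Cinf_on (\<phi> ` (U \<inter> W)) (\<lambda>x. f (inv_into U \<phi> x)))"

definition smooth_near ::
  "('m::topological_space, 'n::finite) chart set \<Rightarrow> 'm \<Rightarrow> ('m \<Rightarrow> real) \<Rightarrow> bool" where
  "smooth_near A p f \<longleftrightarrow> (\<exists>W. p \<in> W \<and> smooth_fun_on A W f)"

section \<open>Tangent vectors, vector fields and tensor fields\<close>

text \<open>Tangent vectors at \<open>p\<close> are the directional derivatives at \<open>p\<close>, acting on the functions that
  are smooth near \<open>p\<close>. They are set to 0 on all other functions, so that equality of tangent
  vectors is equality of functionals.\<close>

type_synonym 'm tvec = "('m \<Rightarrow> real) \<Rightarrow> real"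
type_synonym 'm vfield = "'m \<Rightarrow> 'm tvec"

definition dir_deriv ::
  "('m::topological_space, 'n::finite) chart set \<Rightarrow> ('m, 'n) chart \<Rightarrow> 'm \<Rightarrow> real^'n \<Rightarrow> 'm tvec" where
  "dir_deriv A c p a = (\<lambda>f. if smooth_near A p f
     then frechet_derivative (\<lambda>x. f (inv_into (fst c) (snd c) x)) (at (snd c p)) a else 0)"

definition tangent_space ::
  "('m::topological_space, 'n::finite) chart set \<Rightarrow> 'm \<Rightarrow> 'm tvec set" where
  "tangent_space A p = {dir_deriv A c p a | c a. c \<in> A \<and> p \<in> fst c}"

definition vf_add :: "'m vfield \<Rightarrow> 'm vfield \<Rightarrow> 'm vfield" where
  "vf_add X Y = (\<lambda>p f. X p f + Y p f)"

definition vf_scale :: "('m \<Rightarrow> real) \<Rightarrow> 'm vfield \<Rightarrow> 'm vfield" where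
  "vf_scale h X = (\<lambda>p f. h p * X p f)"

definition vector_field_on ::
  "('m::topological_space, 'n::finite) chart set \<Rightarrow> 'm set \<Rightarrow> 'm vfield \<Rightarrow> bool" where
  "vector_field_on A W X \<longleftrightarrow> open W \<and> (\<forall>p\<in>W. X p \<in> tangent_space A p) \<and>
     (\<forall>V f. smooth_fun_on A V f \<longrightarrow> smooth_fun_on A (W \<inter> V) (\<lambda>q. X q f))"

definition lie_bracket ::
  "('m::topological_space, 'n::finite) chart set \<Rightarrow> 'm vfield \<Rightarrow> 'm vfield \<Rightarrow> 'm vfield" where
  "lie_bracket A X Y = (\<lambda>p f. if smooth_near A p f
     then X p (\<lambda>q. Y q f) - Y p (\<lambda>q. X q f) else 0)"

text \<open>Tensor fields on the manifold are maps on vector fields that are multilinear over the smooth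
  functions. They, and the connections below, take vector fields on arbitrary open sets \<open>W\<close> as
  arguments; what a field is outside of \<open>W\<close> does not influence the value on \<open>W\<close>, by linearity over
  functions such as the indicator function of \<open>W\<close>, which is smooth on \<open>W\<close>.\<close>

type_synonym 'm form1 = "'m vfield \<Rightarrow> 'm \<Rightarrow> real"
type_synonym 'm tensor2 = "'m vfield \<Rightarrow> 'm vfield \<Rightarrow> 'm \<Rightarrow> real"
type_synonym 'm connection = "'m vfield \<Rightarrow> 'm vfield \<Rightarrow> 'm vfield"

definition one_form ::
  "('m::topological_space, 'n::finite) chart set \<Rightarrow> 'm form1 \<Rightarrow> bool" where
  "one_form A \<gamma> \<longleftrightarrow> (\<forall>W X Y h.
     vector_field_on A W X \<longrightarrow> vector_field_on A W Y \<longrightarrow> smooth_fun_on A W h \<longrightarrow>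
       smooth_fun_on A W (\<gamma> X) \<and>
       (\<forall>p\<in>W. \<gamma> (vf_add X Y) p = \<gamma> X p + \<gamma> Y p \<and> \<gamma> (vf_scale h X) p = h p * \<gamma> X p))"

definition riemannian_metric ::
  "('m::topological_space, 'n::finite) chart set \<Rightarrow> 'm tensor2 \<Rightarrow> bool" where
  "riemannian_metric A g \<longleftrightarrow> (\<forall>W X Y Z h.
     vector_field_on A W X \<longrightarrow> vector_field_on A W Y \<longrightarrow> vector_field_on A W Z \<longrightarrow>
     smooth_fun_on A W h \<longrightarrow>
       smooth_fun_on A W (g X Y) \<and>
       (\<forall>p\<in>W. g X Y p = g Y X p \<and>
         g (vf_add X Z) Y p = g X Y p + g Z Y p \<and>
         g (vf_scale h X) Y p = h p * g X Y p \<and>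
         (X p \<noteq> (\<lambda>_. 0) \<longrightarrow> g X X p > 0)))"

section \<open>The Levi-Civita connection\<close>

definition affine_connection ::
  "('m::topological_space, 'n::finite) chart set \<Rightarrow> 'm connection \<Rightarrow> bool" where
  "affine_connection A D \<longleftrightarrow> (\<forall>W X Y Z h.
     vector_field_on A W X \<longrightarrow> vector_field_on A W Y \<longrightarrow> vector_field_on A W Z \<longrightarrow>
     smooth_fun_on A W h \<longrightarrow>
       vector_field_on A W (D X Y) \<and>
       (\<forall>p\<in>W.
         D (vf_add X Z) Y p = (\<lambda>f. D X Y p f + D Z Y p f) \<and>
         D (vf_scale h X) Y p = (\<lambda>f. h p * D X Y p f) \<and>
         D X (vf_add Y Z) p = (\<lambda>f. D X Y p f + D X Z p f) \<and>
         D X (vf_scale h Y) p = (\<lambda>f. X p h * Y p f + h p * D X Y p f)))"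

definition levi_civita ::
  "('m::topological_space, 'n::finite) chart set \<Rightarrow> 'm tensor2 \<Rightarrow> 'm connection \<Rightarrow> bool" where
  "levi_civita A g D \<longleftrightarrow> affine_connection A D \<and>
     (\<forall>W X Y Z. vector_field_on A W X \<longrightarrow> vector_field_on A W Y \<longrightarrow> vector_field_on A W Z \<longrightarrow>
       (\<forall>p\<in>W.
         (\<lambda>f. D X Y p f - D Y X p f) = lie_bracket A X Y p \<and>
         X p (g Y Z) = g (D X Y) Z p + g Y (D X Z) p))"

text \<open>The covariant differentials \<open>(\<nabla>\<gamma>)(X, Y) = (\<nabla>\<^sub>X \<gamma>)(Y)\<close> and
  \<open>(\<nabla>T)(X, Y, Z) = (\<nabla>\<^sub>X T)(Y, Z)\<close>.\<close>

definition nabla1 :: "'m connection \<Rightarrow> 'm form1 \<Rightarrow> 'm tensor2" where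
  "nabla1 D \<gamma> X Y p = X p (\<gamma> Y) - \<gamma> (D X Y) p"

definition nabla2 ::
  "'m connection \<Rightarrow> 'm tensor2 \<Rightarrow> 'm vfield \<Rightarrow> 'm vfield \<Rightarrow> 'm vfield \<Rightarrow> 'm \<Rightarrow> real" where
  "nabla2 D T X Y Z p = X p (T Y Z) - T (D X Y) Z p - T Y (D X Z) p"

section \<open>Traces and inner products with respect to the metric\<close>

definition orthonormal_frame_on ::
  "('m::topological_space, 'n::finite) chart set \<Rightarrow> 'm tensor2 \<Rightarrow> 'm set \<Rightarrow> ('n \<Rightarrow> 'm vfield) \<Rightarrow> bool"
  where
  "orthonormal_frame_on A g W E \<longleftrightarrow> (\<forall>i. vector_field_on A W (E i)) \<and>
     (\<forall>i j. \<forall>q\<in>W. g (E i) (E j) q = (if i = j then 1 else 0))"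

text \<open>All quantities defined by means of this choice of a frame are independent of it.\<close>

definition frame_near ::
  "('m::topological_space, 'n::finite) chart set \<Rightarrow> 'm tensor2 \<Rightarrow> 'm \<Rightarrow> 'n \<Rightarrow> 'm vfield" where
  "frame_near A g p = (SOME E. \<exists>W. p \<in> W \<and> orthonormal_frame_on A g W E)"

definition inner1 ::
  "('m::topological_space, 'n::finite) chart set \<Rightarrow> 'm tensor2 \<Rightarrow> 'm form1 \<Rightarrow> 'm form1 \<Rightarrow> 'm \<Rightarrow> real"
  where
  "inner1 A g \<alpha> \<beta> p = (\<Sum>i\<in>UNIV. \<alpha> (frame_near A g p i) p * \<beta> (frame_near A g p i) p)"

definition inner2 ::
  "('m::topological_space, 'n::finite) chart set \<Rightarrow> 'm tensor2 \<Rightarrow> 'm tensor2 \<Rightarrow> 'm tensor2 \<Rightarrow> 'm \<Rightarrow> real"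
  where
  "inner2 A g S T p = (\<Sum>i\<in>UNIV. \<Sum>j\<in>UNIV.
     S (frame_near A g p i) (frame_near A g p j) p * T (frame_near A g p i) (frame_near A g p j) p)"

definition orthogonal1 ::
  "('m::topological_space, 'n::finite) chart set \<Rightarrow> 'm tensor2 \<Rightarrow> 'm form1 \<Rightarrow> 'm form1 \<Rightarrow> bool" where
  "orthogonal1 A g \<alpha> \<beta> \<longleftrightarrow> (\<forall>p. inner1 A g \<alpha> \<beta> p = 0)"

definition orthogonal2 ::
  "('m::topological_space, 'n::finite) chart set \<Rightarrow> 'm tensor2 \<Rightarrow> 'm tensor2 \<Rightarrow> 'm tensor2 \<Rightarrow> bool"
  where
  "orthogonal2 A g S T \<longleftrightarrow> (\<forall>p. inner2 A g S T p = 0)"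

definition curvature ::
  "('m::topological_space, 'n::finite) chart set \<Rightarrow> 'm connection \<Rightarrow>
     'm vfield \<Rightarrow> 'm vfield \<Rightarrow> 'm vfield \<Rightarrow> 'm vfield" where
  "curvature A D X Y Z =
     (\<lambda>p f. D X (D Y Z) p f - D Y (D X Z) p f - D (lie_bracket A X Y) Z p f)"

text \<open>The trace of \<open>X \<mapsto> R(X, Y)Z\<close>; the sign is the one for which round spheres have positive
  Ricci curvature.\<close>

definition ricci ::
  "('m::topological_space, 'n::finite) chart set \<Rightarrow> 'm tensor2 \<Rightarrow> 'm connection \<Rightarrow> 'm tensor2" where
  "ricci A g D Y Z p =
     (\<Sum>i\<in>UNIV. g (curvature A D (frame_near A g p i) Y Z) (frame_near A g p i) p)"

section \<open>The Laplace-Hodge operator on functions and 1-forms\<close>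

definition extd0 :: "('m \<Rightarrow> real) \<Rightarrow> 'm form1" where
  "extd0 f X p = X p f"

definition extd1 ::
  "('m::topological_space, 'n::finite) chart set \<Rightarrow> 'm form1 \<Rightarrow> 'm tensor2" where
  "extd1 A \<gamma> X Y p = X p (\<gamma> Y) - Y p (\<gamma> X) - \<gamma> (lie_bracket A X Y) p"

text \<open>The codifferential \<open>\<delta>\<alpha> = - \<Sum>\<^sub>i (\<nabla>\<^bsub>E\<^sub>i\<^esub> \<alpha>)(E\<^sub>i, \<dots>)\<close>
  on 1-forms and on 2-forms; this needs neither an orientation nor compactness.\<close>

definition codiff1 ::
  "('m::topological_space, 'n::finite) chart set \<Rightarrow> 'm tensor2 \<Rightarrow> 'm connection \<Rightarrow> 'm form1 \<Rightarrow> 'm \<Rightarrow> real"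
  where
  "codiff1 A g D \<gamma> p = - (\<Sum>i\<in>UNIV. nabla1 D \<gamma> (frame_near A g p i) (frame_near A g p i) p)"

definition codiff2 ::
  "('m::topological_space, 'n::finite) chart set \<Rightarrow> 'm tensor2 \<Rightarrow> 'm connection \<Rightarrow> 'm tensor2 \<Rightarrow> 'm form1"
  where
  "codiff2 A g D \<omega> X p =
     - (\<Sum>i\<in>UNIV. nabla2 D \<omega> (frame_near A g p i) (frame_near A g p i) X p)"

text \<open>The sign is that of \<open>\<Delta> = - (d \<delta> + \<delta> d)\<close>.\<close>

definition laplace0 ::
  "('m::topological_space, 'n::finite) chart set \<Rightarrow> 'm tensor2 \<Rightarrow> 'm connection \<Rightarrow>
     ('m \<Rightarrow> real) \<Rightarrow> 'm \<Rightarrow> real" where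
  "laplace0 A g D u p = - codiff1 A g D (extd0 u) p"

definition laplace1 ::
  "('m::topological_space, 'n::finite) chart set \<Rightarrow> 'm tensor2 \<Rightarrow> 'm connection \<Rightarrow> 'm form1 \<Rightarrow> 'm form1"
  where
  "laplace1 A g D \<gamma> X p =
     - (extd0 (codiff1 A g D \<gamma>) X p + codiff2 A g D (extd1 A \<gamma>) X p)"

definition harmonic0 ::
  "('m::topological_space, 'n::finite) chart set \<Rightarrow> 'm tensor2 \<Rightarrow> 'm connection \<Rightarrow>
     ('m \<Rightarrow> real) \<Rightarrow> bool" where
  "harmonic0 A g D u \<longleftrightarrow> (\<forall>p. laplace0 A g D u p = 0)"

definition harmonic1 ::
  "('m::topological_space, 'n::finite) chart set \<Rightarrow> 'm tensor2 \<Rightarrow> 'm connection \<Rightarrow> 'm form1 \<Rightarrow> bool"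
  where
  "harmonic1 A g D \<gamma> \<longleftrightarrow>
     (\<forall>W X. vector_field_on A W X \<longrightarrow> (\<forall>p\<in>W. laplace1 A g D \<gamma> X p = 0))"

section \<open>Gradient \<open>\<eta>\<close>-Ricci solitons\<close>

definition is_gradient ::
  "('m::topological_space, 'n::finite) chart set \<Rightarrow> 'm tensor2 \<Rightarrow> ('m \<Rightarrow> real) \<Rightarrow> 'm vfield \<Rightarrow> bool"
  where
  "is_gradient A g f \<xi> \<longleftrightarrow> vector_field_on A UNIV \<xi> \<and>
     (\<forall>W X. vector_field_on A W X \<longrightarrow> (\<forall>p\<in>W. g \<xi> X p = extd0 f X p))"

definition hess :: "'m connection \<Rightarrow> ('m \<Rightarrow> real) \<Rightarrow> 'm tensor2" where
  "hess D f = nabla1 D (extd0 f)"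

definition lie_deriv ::
  "('m::topological_space, 'n::finite) chart set \<Rightarrow> 'm vfield \<Rightarrow> 'm tensor2 \<Rightarrow> 'm tensor2" where
  "lie_deriv A \<xi> T X Y p =
     \<xi> p (T X Y) - T (lie_bracket A \<xi> X) Y p - T X (lie_bracket A \<xi> Y) p"

definition eta_ricci_soliton ::
  "('m::topological_space, 'n::finite) chart set \<Rightarrow> 'm tensor2 \<Rightarrow> 'm connection \<Rightarrow>
     'm vfield \<Rightarrow> 'm form1 \<Rightarrow> real \<Rightarrow> real \<Rightarrow> bool" where
  "eta_ricci_soliton A g D \<xi> \<eta> lam \<mu> \<longleftrightarrow>
     (\<forall>W X Y. vector_field_on A W X \<longrightarrow> vector_field_on A W Y \<longrightarrow>
       (\<forall>p\<in>W. lie_deriv A \<xi> g X Y p + 2 * ricci A g D X Y p + 2 * lam * g X Y p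
          + 2 * \<mu> * \<eta> X p * \<eta> Y p = 0))"

end

theory Submission
  imports Defs "HOL-Library.Function_Algebras"
begin

text \<open>
  Near a given point let \<open>C\<close> be the vector field dual to \<open>\<gamma>\<close>, so that \<open>\<langle>df, \<gamma>\<rangle> = \<gamma>(\<xi>) = g(\<xi>, C)\<close>.
  Expanding the Laplacian of this product and using the Weitzenboeck formula
  \<open>\<Delta>\<gamma>(X) = g(\<Sum>\<^sub>i \<nabla>\<^sup>2\<^bsub>E\<^sub>i,E\<^sub>i\<^esub> C, X) - S(X, C)\<close> for \<open>\<gamma>\<close> and
  \<open>g(\<Sum>\<^sub>i \<nabla>\<^sup>2\<^bsub>E\<^sub>i,E\<^sub>i\<^esub> \<xi>, X) = X(\<Delta>f) + S(X, \<xi>)\<close> for the gradient field \<open>\<xi>\<close> gives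
  \<open>\<Delta>\<langle>df, \<gamma>\<rangle> = \<langle>df, \<Delta>\<gamma>\<rangle> + 2\<langle>Hess(f), \<nabla>\<gamma>\<rangle> + C(\<Delta>f) + 2 S(C, \<xi>)\<close>.
  The trace and the divergence of the soliton equation, combined by means of the contracted
  second Bianchi identity, turn the last two terms into \<open>- 2 \<mu> \<Delta>(f) \<langle>df, \<gamma>\<rangle>\<close>.
  All claims follow from the resulting identity.
\<close>

section \<open>Smooth functions on open subsets of Euclidean space\<close>

text \<open>Traces such as \<open>ricci\<close> and \<open>codiff1\<close> use
  \<open>frame_near A g p\<close>, a frame chosen anew at every point, whereas the argument
  differentiates them. They are therefore rewritten in one frame on an open set inside a chart,
  where the calculus becomes pure algebra; fields that agree on this set are interchangeable by
  linearity over its indicator function. The weight \<open>-2\<close> of the \<open>\<mu>\<close>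
  term has this origin. The trace of the soliton equation, differentiated along \<open>Y\<close>,
  contains \<open>2 \<mu> Hess(f)(Y, \<xi>)\<close>; twice the divergence contains the same term,
  and the contracted Bianchi identity makes the two cancel. What remains is
  \<open>Y(\<Delta>f) = - 2 S(Y, \<xi>) - 2 \<mu> \<Delta>(f) df(Y)\<close>, whose Ricci part is
  used up by the two Ricci terms that the rough Laplacians of \<open>\<xi>\<close> and
  \<open>C\<close> produce.\<close>

lemma Ck_on_SucD: "Ck_on (Suc k) h S \<Longrightarrow> Ck_on k h S"
  by (induction k arbitrary: h) (auto simp: differentiable_imp_continuous_on)

text \<open>On an open set the values determine the derivatives, so agreement passes to the partial
  derivatives in the induction. The closure lemmas below compute a derivative by a formula valid on
  \<open>S\<close> only and then transfer.\<close>

lemma Ck_on_transfer: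
  fixes f h :: "real^'n \<Rightarrow> real"
  assumes "open S" "Ck_on k h S" "\<And>x. x \<in> S \<Longrightarrow> f x = h x"
  shows "Ck_on k f S"
  using assms(2,3)
proof (induction k arbitrary: f h)
  case 0
  then show ?case by (simp cong: continuous_on_cong)
next
  case (Suc k)
  have hd: "h differentiable at x" if "x \<in> S" for x
    using Suc.prems that \<open>open S\<close> by (auto simp: differentiable_on_eq_differentiable_at)
  have "f differentiable at x" if "x \<in> S" for x
  proof (rule differentiableI)
    show "(f has_derivative frechet_derivative h (at x)) (at x)"
      by (rule has_derivative_transform_within_open[of h _ x UNIV S f])
         (use hd[OF that] Suc.prems(2) \<open>open S\<close> that in \<open>simp_all add: frechet_derivative_works\<close>)
  qed
  moreover have "frechet_derivative f (at x) = frechet_derivative h (at x)" if "x \<in> S" for x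
    using Suc.prems \<open>open S\<close> that hd
    by (intro frechet_derivative_transform_within_open[of h _ S, symmetric]) auto
  then have "Ck_on k (\<lambda>x. frechet_derivative f (at x) (axis i 1)) S" for i
    using Suc.prems by - (rule Suc.IH[of "\<lambda>x. frechet_derivative h (at x) (axis i 1)"], auto)
  ultimately show ?case
    using \<open>open S\<close> by (auto simp: differentiable_on_eq_differentiable_at)
qed

lemma Ck_on_subset: "Ck_on k h S \<Longrightarrow> T \<subseteq> S \<Longrightarrow> Ck_on k h T"
  by (induction k arbitrary: h) (auto intro: continuous_on_subset differentiable_on_subset)

lemma Ck_on_const [simp]: "Ck_on k (\<lambda>x. c) S"
  by (induction k arbitrary: c) auto

lemma Ck_on_add:
  assumes "open S" "Ck_on k f S" "Ck_on k h S"
  shows "Ck_on k (\<lambda>x. f x + h x) S"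
  using assms(2,3)
proof (induction k arbitrary: f h)
  case 0
  then show ?case by (auto intro: continuous_intros)
next
  case (Suc k)
  have "Ck_on k (\<lambda>x. frechet_derivative (\<lambda>x. f x + h x) (at x) (axis i 1)) S" for i
  proof -
    have "frechet_derivative (\<lambda>x. f x + h x) (at x) (axis i 1)
        = frechet_derivative f (at x) (axis i 1) + frechet_derivative h (at x) (axis i 1)"
      if "x \<in> S" for x
      using Suc.prems that \<open>open S\<close>
      by (intro fun_cong[OF frechet_derivative_at[symmetric, OF has_derivative_add]])
         (auto simp: differentiable_on_eq_differentiable_at frechet_derivative_works)
    moreover have "Ck_on k (\<lambda>x. frechet_derivative f (at x) (axis i 1)
        + frechet_derivative h (at x) (axis i 1)) S"
      using Suc by auto
    ultimately show ?thesis
      by (rule Ck_on_transfer[OF \<open>open S\<close>, rotated])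
  qed
  then show ?case using Suc.prems by (auto intro: derivative_intros)
qed

lemma Ck_on_mult:
  assumes "open S" "Ck_on k f S" "Ck_on k h S"
  shows "Ck_on k (\<lambda>x. f x * h x) S"
  using assms(2,3)
proof (induction k arbitrary: f h)
  case 0
  then show ?case by (auto intro: continuous_intros)
next
  case (Suc k)
  have "Ck_on k (\<lambda>x. frechet_derivative (\<lambda>x. f x * h x) (at x) (axis i 1)) S" for i
  proof -
    have "frechet_derivative (\<lambda>x. f x * h x) (at x) (axis i 1)
        = f x * frechet_derivative h (at x) (axis i 1) + frechet_derivative f (at x) (axis i 1) * h x"
      if "x \<in> S" for x
      using Suc.prems that \<open>open S\<close>
      by (intro fun_cong[OF frechet_derivative_at[symmetric, OF has_derivative_mult]])
         (auto simp: differentiable_on_eq_differentiable_at frechet_derivative_works)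
    moreover have "Ck_on k (\<lambda>x. f x * frechet_derivative h (at x) (axis i 1)
       + frechet_derivative f (at x) (axis i 1) * h x) S"
      using Suc.prems Ck_on_SucD[OF Suc.prems(1)] Ck_on_SucD[OF Suc.prems(2)]
      by (intro Ck_on_add[OF \<open>open S\<close>] Suc.IH) auto
    ultimately show ?thesis
      by (rule Ck_on_transfer[OF \<open>open S\<close>, rotated])
  qed
  then show ?case using Suc.prems by (auto intro: differentiable_on_mult)
qed

lemma Ck_on_sum:
  assumes "open S" "finite I" "\<And>i. i \<in> I \<Longrightarrow> Ck_on k (f i) S"
  shows "Ck_on k (\<lambda>x. \<Sum>i\<in>I. f i x) S"
  using assms(2,3) by (induction I rule: finite_induct) (auto intro: Ck_on_add[OF \<open>open S\<close>])

lemma linear_expand_axis: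
  fixes L :: "real^'n \<Rightarrow> real"
  assumes "linear L"
  shows "L a = (\<Sum>i\<in>UNIV. a $ i * L (axis i 1))"
proof -
  have "L a = L (\<Sum>i\<in>UNIV. a $ i *\<^sub>R axis i 1)"
    by (metis (no_types) basis_expansion scalar_mult_eq_scaleR)
  also have "\<dots> = (\<Sum>i\<in>UNIV. a $ i * L (axis i 1))"
    by (simp add: linear_sum[OF assms] linear_scale[OF assms])
  finally show ?thesis .
qed

text \<open>The chain rule in components: \<open>Ck_on\<close> speaks of real-valued functions, so a
  transition map is known only through its coordinates.\<close>

lemma frechet_derivative_compose_components:
  fixes \<tau> :: "real^'m \<Rightarrow> real^'n" and h :: "real^'n \<Rightarrow> real"
  assumes "\<And>j. (\<lambda>x. \<tau> x $ j) differentiable at x" "h differentiable at (\<tau> x)"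
  shows "(\<lambda>x. h (\<tau> x)) differentiable at x"
    "frechet_derivative (\<lambda>x. h (\<tau> x)) (at x) a
       = frechet_derivative h (at (\<tau> x)) (\<chi> j. frechet_derivative (\<lambda>x. \<tau> x $ j) (at x) a)"
proof -
  have "(\<tau> has_derivative (\<lambda>a. \<chi> j. frechet_derivative (\<lambda>x. \<tau> x $ j) (at x) a)) (at x)"
    using assms(1) by (subst has_derivative_componentwise_within)
      (auto simp: Basis_vec_def inner_axis frechet_derivative_works)
  from diff_chain_at[OF this] assms(2)
  have *: "((\<lambda>x. h (\<tau> x)) has_derivative (\<lambda>a. frechet_derivative h (at (\<tau> x))
      (\<chi> j. frechet_derivative (\<lambda>x. \<tau> x $ j) (at x) a))) (at x)"
    by (auto simp: frechet_derivative_works o_def)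
  then show "(\<lambda>x. h (\<tau> x)) differentiable at x" by (auto simp: differentiable_def)
  show "frechet_derivative (\<lambda>x. h (\<tau> x)) (at x) a
       = frechet_derivative h (at (\<tau> x)) (\<chi> j. frechet_derivative (\<lambda>x. \<tau> x $ j) (at x) a)"
    by (simp flip: frechet_derivative_at[OF *])
qed

text \<open>By the chain rule a partial derivative of the composition is a sum of products of
  partial derivatives of \<open>\<tau>\<close> with partial derivatives of \<open>h\<close> composed
  with \<open>\<tau>\<close>. The latter fall under the induction hypothesis, which is why
  \<open>h\<close> is generalised; for them \<open>\<tau>\<close> is weakened by one order.\<close>

lemma Ck_on_compose:
  fixes \<tau> :: "real^'m \<Rightarrow> real^'n" and h :: "real^'n \<Rightarrow> real"
  assumes "open S" "open T" "\<tau> ` S \<subseteq> T" "\<And>j. Ck_on k (\<lambda>x. \<tau> x $ j) S" "Ck_on k h T"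
  shows "Ck_on k (\<lambda>x. h (\<tau> x)) S"
  using assms(4,5)
proof (induction k arbitrary: h)
  case 0
  then have "continuous_on S \<tau>"
    using continuous_on_vec_lambda[of S "\<lambda>j x. \<tau> x $ j"] by simp
  with 0 show ?case
    using continuous_on_compose2[of T h S \<tau>] assms(3) by simp
next
  case (Suc k)
  have dt: "(\<lambda>x. \<tau> x $ j) differentiable at x" and dh: "h differentiable at (\<tau> x)" if "x \<in> S" for x j
    using Suc.prems that assms(1-3)
    by (simp_all add: differentiable_on_eq_differentiable_at image_subset_iff)
  have "Ck_on k (\<lambda>x. frechet_derivative (\<lambda>x. h (\<tau> x)) (at x) (axis i 1)) S" for i
  proof -
    have "frechet_derivative (\<lambda>x. h (\<tau> x)) (at x) (axis i 1)
        = (\<Sum>j\<in>UNIV. frechet_derivative (\<lambda>x. \<tau> x $ j) (at x) (axis i 1)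
            * frechet_derivative h (at (\<tau> x)) (axis j 1))"
      if "x \<in> S" for x
      using frechet_derivative_compose_components(2)[of \<tau> x h "axis i 1"] dt[OF that] dh[OF that]
        linear_expand_axis[OF linear_frechet_derivative[OF dh[OF that]],
          of "\<chi> j. frechet_derivative (\<lambda>x. \<tau> x $ j) (at x) (axis i 1)"]
      by simp
    moreover have "Ck_on k (\<lambda>x. (\<Sum>j\<in>UNIV. frechet_derivative (\<lambda>x. \<tau> x $ j) (at x) (axis i 1)
            * frechet_derivative h (at (\<tau> x)) (axis j 1))) S"
    proof (intro Ck_on_sum Ck_on_mult \<open>open S\<close>)
      fix j
      show "Ck_on k (\<lambda>x. frechet_derivative (\<lambda>x. \<tau> x $ j) (at x) (axis i 1)) S"
        using Suc.prems(1)[of j] by simp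
      show "Ck_on k (\<lambda>x. frechet_derivative h (at (\<tau> x)) (axis j 1)) S"
        using Suc.prems(2) by - (rule Suc.IH[OF Ck_on_SucD[OF Suc.prems(1)]], simp)
    qed simp
    ultimately show ?thesis
      by (rule Ck_on_transfer[OF \<open>open S\<close>, rotated])
  qed
  moreover have "(\<lambda>x. h (\<tau> x)) differentiable_on S"
    using frechet_derivative_compose_components(1)[of \<tau> _ h] dt dh
    by (simp add: differentiable_on_eq_differentiable_at \<open>open S\<close>)
  ultimately show ?case by simp
qed

text \<open>The derivative of \<open>h\<close> to the power -1/2 is -1/2 times the cube of that same
  function times \<open>h'\<close>, so the induction closes on a single function. It is needed to
  normalise vectors in the Gram-Schmidt process.\<close>

lemma Ck_on_inverse_sqrt:
  assumes "open S" "Ck_on k h S" "\<And>x. x \<in> S \<Longrightarrow> h x > 0"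
  shows "Ck_on k (\<lambda>x. inverse (sqrt (h x))) S"
  using assms(2)
proof (induction k)
  case 0
  then show ?case
    using assms(3) by (auto intro!: continuous_on_inverse continuous_on_real_sqrt simp: less_imp_neq[symmetric])
next
  case (Suc k)
  have D: "((\<lambda>x. inverse (sqrt (h x))) has_derivative
      (\<lambda>a. - (1/2) * (inverse (sqrt (h x)) * (inverse (sqrt (h x)) * (inverse (sqrt (h x))
         * frechet_derivative h (at x) a))))) (at x)" if "x \<in> S" for x
  proof -
    have hd: "(h has_derivative frechet_derivative h (at x)) (at x)"
      using Suc.prems that assms(1)
      by (auto simp: differentiable_on_eq_differentiable_at frechet_derivative_works)
    have p: "h x > 0" using assms(3) that .
    have "((\<lambda>x. sqrt (h x)) has_derivative (\<lambda>a. inverse (2 * sqrt (h x)) * frechet_derivative h (at x) a)) (at x)"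
      using has_derivative_real_sqrt[OF p hd] p by (simp add: field_simps)
    from Deriv.has_derivative_inverse[OF _ this] p show ?thesis
      by (simp add: ac_simps)
  qed
  have "Ck_on k (\<lambda>x. frechet_derivative (\<lambda>x. inverse (sqrt (h x))) (at x) (axis i 1)) S" for i
  proof -
    have "frechet_derivative (\<lambda>x. inverse (sqrt (h x))) (at x) (axis i 1) =
      - (1/2) * (inverse (sqrt (h x)) * (inverse (sqrt (h x)) * (inverse (sqrt (h x))
         * frechet_derivative h (at x) (axis i 1))))" if "x \<in> S" for x
      by (simp flip: frechet_derivative_at[OF D[OF that]])
    moreover have "Ck_on k (\<lambda>x. - (1/2) * (inverse (sqrt (h x)) * (inverse (sqrt (h x)) * (inverse (sqrt (h x))
         * frechet_derivative h (at x) (axis i 1))))) S"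
      using Suc.prems Suc.IH[OF Ck_on_SucD[OF Suc.prems]]
      by (intro Ck_on_mult \<open>open S\<close> Ck_on_const) auto
    ultimately show ?thesis
      by (rule Ck_on_transfer[OF \<open>open S\<close>, rotated])
  qed
  then show ?case
    using D by (auto simp: differentiable_on_eq_differentiable_at \<open>open S\<close> differentiable_def)
qed

section \<open>Smooth functions, tangent vectors and vector fields\<close>

lemma Cinf_on_CkD: "Cinf_on S h \<Longrightarrow> Ck_on k h S"
  by (simp add: Cinf_on_def)

lemma Cinf_on_derivative: "Cinf_on S h \<Longrightarrow> Cinf_on S (\<lambda>x. frechet_derivative h (at x) (axis i 1))"
  by (simp add: Cinf_on_def) (metis Ck_on.simps(2))

lemma Cinf_on_differentiable: "Cinf_on S h \<Longrightarrow> open S \<Longrightarrow> x \<in> S \<Longrightarrow> h differentiable at x"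
  using Cinf_on_CkD[of S h 1] by (simp add: differentiable_on_eq_differentiable_at)

locale differentiable_manifold =
  fixes A :: "('m::{t2_space,second_countable_topology}, 'n::finite) chart set"
  assumes A: "smooth_manifold A"
begin

lemma chart_homeomorphism: "(U, \<phi>) \<in> A \<Longrightarrow> homeomorphism U (\<phi> ` U) \<phi> (inv_into U \<phi>)"
  and open_chart: "(U, \<phi>) \<in> A \<Longrightarrow> open U"
  and open_chart_range: "(U, \<phi>) \<in> A \<Longrightarrow> open (\<phi> ` U)"
  and transition_Cinf: "(U, \<phi>) \<in> A \<Longrightarrow> (V', \<psi>) \<in> A \<Longrightarrow>
    Cinf_on (\<phi> ` (U \<inter> V')) (\<lambda>x. \<psi> (inv_into U \<phi> x) $ i)"
  using A by (fastforce simp: smooth_manifold_def)+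

lemma chart_around: obtains U \<phi> where "(U, \<phi>) \<in> A" "p \<in> U"
proof -
  have "p \<in> (\<Union>(U, \<phi>)\<in>A. U)" using A by (simp add: smooth_manifold_def)
  then show ?thesis using that by auto
qed

lemma chart_inverse [simp]: "(U, \<phi>) \<in> A \<Longrightarrow> q \<in> U \<Longrightarrow> inv_into U \<phi> (\<phi> q) = q"
  using chart_homeomorphism by (fastforce simp: homeomorphism_def)

lemma open_chart_image:
  assumes "(U, \<phi>) \<in> A" "open W"
  shows "open (\<phi> ` (U \<inter> W))"
proof -
  have "openin (top_of_set (\<phi> ` U)) (\<phi> ` (U \<inter> W))"
    using homeomorphism_imp_open_map[OF chart_homeomorphism[OF assms(1)]] assms(2)
    by (auto simp: openin_open)
  then show ?thesis
    using open_chart_range[OF assms(1)] openin_open_trans by blast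
qed

lemma smooth_fun_on_const: "open W \<Longrightarrow> smooth_fun_on A W (\<lambda>q. c)"
  by (simp add: smooth_fun_on_def Cinf_on_def)

lemma smooth_fun_on_open: "smooth_fun_on A W f \<Longrightarrow> open W"
  by (simp add: smooth_fun_on_def)

lemma smooth_fun_on_add:
  "smooth_fun_on A W f \<Longrightarrow> smooth_fun_on A W h \<Longrightarrow> smooth_fun_on A W (\<lambda>q. f q + h q)"
  unfolding smooth_fun_on_def Cinf_on_def by (fastforce intro!: Ck_on_add open_chart_image)

lemma smooth_fun_on_mult:
  "smooth_fun_on A W f \<Longrightarrow> smooth_fun_on A W h \<Longrightarrow> smooth_fun_on A W (\<lambda>q. f q * h q)"
  unfolding smooth_fun_on_def Cinf_on_def by (fastforce intro!: Ck_on_mult open_chart_image)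

lemma smooth_fun_on_uminus: "smooth_fun_on A W f \<Longrightarrow> smooth_fun_on A W (\<lambda>q. - f q)"
  using smooth_fun_on_mult[OF smooth_fun_on_const[of W "-1"]] by (simp add: smooth_fun_on_open)

lemma smooth_fun_on_inverse_sqrt:
  assumes "smooth_fun_on A W f" "\<And>q. q \<in> W \<Longrightarrow> f q > 0"
  shows "smooth_fun_on A W (\<lambda>q. inverse (sqrt (f q)))"
  unfolding smooth_fun_on_def Cinf_on_def
proof (safe, goal_cases)
  case 1
  then show ?case using assms(1) by (rule smooth_fun_on_open)
next
  case (2 U \<phi> k)
  have "Ck_on k (\<lambda>x. f (inv_into U \<phi> x)) (\<phi> ` (U \<inter> W))"
    using 2 assms(1) by (fastforce simp: smooth_fun_on_def Cinf_on_def)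
  then show ?case
    using 2 assms by (intro Ck_on_inverse_sqrt open_chart_image) (auto simp: smooth_fun_on_open)
qed

lemma smooth_fun_on_transfer:
  assumes "smooth_fun_on A W f" "\<And>q. q \<in> W \<Longrightarrow> f q = h q"
  shows "smooth_fun_on A W h"
  unfolding smooth_fun_on_def Cinf_on_def
proof (safe, goal_cases)
  case 1
  then show ?case using assms(1) by (rule smooth_fun_on_open)
next
  case (2 U \<phi> k)
  have *: "Ck_on k (\<lambda>x. f (inv_into U \<phi> x)) (\<phi> ` (U \<inter> W))"
    using 2 assms(1) by (fastforce simp: smooth_fun_on_def Cinf_on_def)
  show ?case
    by (rule Ck_on_transfer[OF open_chart_image[OF 2 smooth_fun_on_open[OF assms(1)]] *])
       (use 2 assms(2) in auto)
qed

lemma smooth_fun_on_subset: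
  assumes "smooth_fun_on A W f" "open W'" "W' \<subseteq> W"
  shows "smooth_fun_on A W' f"
  unfolding smooth_fun_on_def Cinf_on_def
proof (safe, goal_cases)
  case 1
  then show ?case using assms(2) .
next
  case (2 U \<phi> k)
  have "Ck_on k (\<lambda>x. f (inv_into U \<phi> x)) (\<phi> ` (U \<inter> W))"
    using 2 assms(1) by (fastforce simp: smooth_fun_on_def Cinf_on_def)
  then show ?case
    by (rule Ck_on_subset) (use assms(3) in auto)
qed

text \<open>In any other chart the coordinate expression is the given one composed with a transition
  map, so one chart suffices to test smoothness inside its domain.\<close>

lemma smooth_fun_on_chartI:
  assumes c: "(U, \<phi>) \<in> A" and W: "open W" "W \<subseteq> U"
    and f: "Cinf_on (\<phi> ` W) (\<lambda>x. f (inv_into U \<phi> x))"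
  shows "smooth_fun_on A W f"
  unfolding smooth_fun_on_def Cinf_on_def
proof (safe, goal_cases)
  case 1
  then show ?case using W(1) .
next
  case (2 V' \<psi> k)
  have oW: "open (\<phi> ` W)"
    using open_chart_image[OF c W(1)] W(2) by (simp add: Int_absorb1)
  have *: "Ck_on k (\<lambda>x. f (inv_into U \<phi> (\<phi> (inv_into V' \<psi> x)))) (\<psi> ` (V' \<inter> W))"
  proof (rule Ck_on_compose[OF open_chart_image[OF 2 W(1)] oW])
    show "(\<lambda>x. \<phi> (inv_into V' \<psi> x)) ` \<psi> ` (V' \<inter> W) \<subseteq> \<phi> ` W"
      using 2 by auto
    show "Ck_on k (\<lambda>x. \<phi> (inv_into V' \<psi> x) $ j) (\<psi> ` (V' \<inter> W))" for j
      by (rule Ck_on_subset[OF Cinf_on_CkD[OF transition_Cinf[OF 2 c]]]) (use W in auto)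
    show "Ck_on k (\<lambda>x. f (inv_into U \<phi> x)) (\<phi> ` W)"
      using f by (rule Cinf_on_CkD)
  qed
  show ?case
    by (rule Ck_on_transfer[OF open_chart_image[OF 2 W(1)] *]) (use 2 c W in \<open>auto simp: subset_iff\<close>)
qed

lemma smooth_coordinate: "(U, \<phi>) \<in> A \<Longrightarrow> smooth_fun_on A U (\<lambda>q. \<phi> q $ i)"
  unfolding smooth_fun_on_def using transition_Cinf by (auto intro: open_chart)

lemma smooth_nearI: "smooth_fun_on A W f \<Longrightarrow> p \<in> W \<Longrightarrow> smooth_near A p f"
  by (auto simp: smooth_near_def)

lemma smooth_near_transfer:
  assumes "smooth_near A p f" "open S" "p \<in> S" "\<And>q. q \<in> S \<Longrightarrow> f q = h q"
  shows "smooth_near A p h"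
proof -
  obtain W where W: "p \<in> W" "smooth_fun_on A W f" using assms by (auto simp: smooth_near_def)
  then have "smooth_fun_on A (W \<inter> S) f"
    using assms by (intro smooth_fun_on_subset[OF W(2)]) (auto simp: smooth_fun_on_open)
  then have "smooth_fun_on A (W \<inter> S) h"
    by (rule smooth_fun_on_transfer) (use assms in auto)
  then show ?thesis using W assms by (auto simp: smooth_near_def)
qed

lemma smooth_near2E:
  assumes "smooth_near A p f" "smooth_near A p h"
  obtains W where "p \<in> W" "smooth_fun_on A W f" "smooth_fun_on A W h"
proof -
  obtain W1 W2 where W: "p \<in> W1" "smooth_fun_on A W1 f" "p \<in> W2" "smooth_fun_on A W2 h"
    using assms by (auto simp: smooth_near_def)
  then have "smooth_fun_on A (W1 \<inter> W2) f" "smooth_fun_on A (W1 \<inter> W2) h"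
    by (meson open_Int smooth_fun_on_open smooth_fun_on_subset Int_lower1 Int_lower2)+
  then show ?thesis using that W by auto
qed

lemma smooth_near_differentiable:
  assumes "smooth_near A p f" "(U, \<phi>) \<in> A" "p \<in> U"
  shows "(\<lambda>x. f (inv_into U \<phi> x)) differentiable at (\<phi> p)"
proof -
  obtain W where W: "p \<in> W" "smooth_fun_on A W f" using assms by (auto simp: smooth_near_def)
  then have "Cinf_on (\<phi> ` (U \<inter> W)) (\<lambda>x. f (inv_into U \<phi> x))"
    using assms by (auto simp: smooth_fun_on_def)
  from Cinf_on_differentiable[OF this open_chart_image] show ?thesis
    using W assms by (auto simp: smooth_fun_on_open)
qed

text \<open>The components transform by the Jacobian of the transition map. On functions that are
  not smooth near \<open>p\<close> both sides are 0 by definition. Consequently each single chart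
  around \<open>p\<close> yields the whole tangent space, and vectors coming from different charts
  can be added.\<close>

lemma dir_deriv_change_chart:
  assumes c: "(U, \<phi>) \<in> A" "p \<in> U" and c': "(V', \<psi>) \<in> A" "p \<in> V'"
  shows "dir_deriv A (V', \<psi>) p a = dir_deriv A (U, \<phi>) p
    (\<chi> j. frechet_derivative (\<lambda>x. \<phi> (inv_into V' \<psi> x) $ j) (at (\<psi> p)) a)"
proof
  fix f
  let ?S = "\<psi> ` (V' \<inter> U)"
  have S: "open ?S" "\<psi> p \<in> ?S" using c c' by (auto intro: open_chart_image open_chart)
  show "dir_deriv A (V', \<psi>) p a f = dir_deriv A (U, \<phi>) p
    (\<chi> j. frechet_derivative (\<lambda>x. \<phi> (inv_into V' \<psi> x) $ j) (at (\<psi> p)) a) f"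
  proof (cases "smooth_near A p f")
    case True
    have d: "(\<lambda>x. \<phi> (inv_into V' \<psi> x) $ j) differentiable at (\<psi> p)" for j
      using Cinf_on_differentiable[OF transition_Cinf[OF c'(1) c(1)] S] .
    have "frechet_derivative (\<lambda>x. f (inv_into V' \<psi> x)) (at (\<psi> p))
      = frechet_derivative (\<lambda>x. f (inv_into U \<phi> (\<phi> (inv_into V' \<psi> x)))) (at (\<psi> p))"
      by (rule frechet_derivative_transform_within_open[OF smooth_near_differentiable[OF True c'] S])
         (use c c' in auto)
    then show ?thesis
      using frechet_derivative_compose_components(2)[of "\<lambda>x. \<phi> (inv_into V' \<psi> x)" "\<psi> p"
          "\<lambda>x. f (inv_into U \<phi> x)" a] d smooth_near_differentiable[OF True c] c c'
      by (simp add: dir_deriv_def True)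
  qed (simp add: dir_deriv_def)
qed

lemma tangent_space_chart:
  assumes "(U, \<phi>) \<in> A" "p \<in> U"
  shows "tangent_space A p = range (dir_deriv A (U, \<phi>) p)"
proof
  show "tangent_space A p \<subseteq> range (dir_deriv A (U, \<phi>) p)"
  proof
    fix t assume "t \<in> tangent_space A p"
    then obtain V' \<psi> a where "t = dir_deriv A (V', \<psi>) p a" "(V', \<psi>) \<in> A" "p \<in> V'"
      by (auto simp: tangent_space_def)
    then show "t \<in> range (dir_deriv A (U, \<phi>) p)"
      using dir_deriv_change_chart[OF assms, of V' \<psi> a] by auto
  qed
  show "range (dir_deriv A (U, \<phi>) p) \<subseteq> tangent_space A p"
    using assms by (force simp: tangent_space_def)
qed

lemma dir_deriv_linear:
  assumes "(U, \<phi>) \<in> A" "p \<in> U"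
  shows "linear (\<lambda>a. dir_deriv A (U, \<phi>) p a f)"
proof (cases "smooth_near A p f")
  case True
  then show ?thesis
    using linear_frechet_derivative[OF smooth_near_differentiable[OF True assms]]
    by (simp add: dir_deriv_def)
next
  case False
  then show ?thesis by (simp add: dir_deriv_def linear_iff)
qed

lemma tangent_space_add:
  assumes "s \<in> tangent_space A p" "t \<in> tangent_space A p"
  shows "(\<lambda>f. s f + t f) \<in> tangent_space A p"
proof -
  obtain U \<phi> where c: "(U, \<phi>) \<in> A" "p \<in> U" by (rule chart_around)
  obtain a b where "s = dir_deriv A (U, \<phi>) p a" "t = dir_deriv A (U, \<phi>) p b"
    using assms by (auto simp: tangent_space_chart[OF c])
  then have "(\<lambda>f. s f + t f) = dir_deriv A (U, \<phi>) p (a + b)"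
    using linear_add[OF dir_deriv_linear[OF c]] by auto
  then show ?thesis by (simp add: tangent_space_chart[OF c])
qed

lemma tangent_space_scale:
  assumes "t \<in> tangent_space A p"
  shows "(\<lambda>f. r * t f) \<in> tangent_space A p"
proof -
  obtain U \<phi> where c: "(U, \<phi>) \<in> A" "p \<in> U" by (rule chart_around)
  obtain a where "t = dir_deriv A (U, \<phi>) p a"
    using assms by (auto simp: tangent_space_chart[OF c])
  then have "(\<lambda>f. r * t f) = dir_deriv A (U, \<phi>) p (r *\<^sub>R a)"
    using linear_scale[OF dir_deriv_linear[OF c]] by auto
  then show ?thesis by (simp add: tangent_space_chart[OF c])
qed

text \<open>Applied to coordinate functions, a tangent vector returns its components; hence it is
  determined by these finitely many values.\<close>

lemma dir_deriv_coordinate: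
  assumes c: "(U, \<phi>) \<in> A" "p \<in> U"
  shows "dir_deriv A (U, \<phi>) p a (\<lambda>q. \<phi> q $ i) = a $ i"
proof -
  have "smooth_near A p (\<lambda>q. \<phi> q $ i)"
    using smooth_coordinate[OF c(1)] c(2) by (rule smooth_nearI)
  moreover have "frechet_derivative (\<lambda>x. \<phi> (inv_into U \<phi> x) $ i) (at (\<phi> p)) = (\<lambda>x. x $ i)"
  proof (rule frechet_derivative_at[symmetric])
    show "((\<lambda>x. \<phi> (inv_into U \<phi> x) $ i) has_derivative (\<lambda>x. x $ i)) (at (\<phi> p))"
      by (rule has_derivative_transform_within_open[OF
            bounded_linear_imp_has_derivative[OF bounded_linear_vec_nth] open_chart_range[OF c(1)]])
         (use c in auto)
  qed
  ultimately show ?thesis by (simp add: dir_deriv_def)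
qed

lemma tangent_space_coordinates:
  assumes c: "(U, \<phi>) \<in> A" "p \<in> U" and t: "t \<in> tangent_space A p"
  shows "t = dir_deriv A (U, \<phi>) p (\<chi> i. t (\<lambda>q. \<phi> q $ i))"
  using t by (auto simp: tangent_space_chart[OF c] dir_deriv_coordinate[OF c])

lemma tangent_vector_expand:
  assumes c: "(U, \<phi>) \<in> A" "p \<in> U" and t: "t \<in> tangent_space A p"
  shows "t f = (\<Sum>i\<in>UNIV. t (\<lambda>q. \<phi> q $ i) * dir_deriv A (U, \<phi>) p (axis i 1) f)"
proof -
  have "dir_deriv A (U, \<phi>) p (\<chi> i. t (\<lambda>q. \<phi> q $ i)) f
    = (\<Sum>i\<in>UNIV. t (\<lambda>q. \<phi> q $ i) * dir_deriv A (U, \<phi>) p (axis i 1) f)"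
    using linear_expand_axis[OF dir_deriv_linear[OF c, of f], of "\<chi> i. t (\<lambda>q. \<phi> q $ i)"] by simp
  then show ?thesis using tangent_space_coordinates[OF assms] by simp
qed

lemma tangent_vector_not_smooth:
  assumes "t \<in> tangent_space A p" "\<not> smooth_near A p f"
  shows "t f = 0"
  using assms by (auto simp: tangent_space_def dir_deriv_def)

text \<open>Smoothness near \<open>p\<close> is itself a local property, so even the default value 0
  is respected. This is the device for replacing a differentiated function by one that agrees with
  it only near the point.\<close>

lemma tangent_vector_local:
  assumes t: "t \<in> tangent_space A p" and S: "open S" "p \<in> S" "\<And>q. q \<in> S \<Longrightarrow> f q = h q"
  shows "t f = t h"
proof (cases "smooth_near A p f")
  case f: True
  have h: "smooth_near A p h" using smooth_near_transfer[OF f S] .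
  obtain U \<phi> where c: "(U, \<phi>) \<in> A" "p \<in> U" by (rule chart_around)
  obtain a where a: "t = dir_deriv A (U, \<phi>) p a"
    using t by (auto simp: tangent_space_chart[OF c])
  have "frechet_derivative (\<lambda>x. f (inv_into U \<phi> x)) (at (\<phi> p))
      = frechet_derivative (\<lambda>x. h (inv_into U \<phi> x)) (at (\<phi> p))"
    by (rule frechet_derivative_transform_within_open[OF smooth_near_differentiable[OF f c]
          open_chart_image[OF c(1) S(1)]])
       (use c S in auto)
  then show ?thesis using f h by (simp add: a dir_deriv_def)
next
  case f: False
  then have "\<not> smooth_near A p h" using smooth_near_transfer[of p h S f] S by auto
  then show ?thesis using f tangent_vector_not_smooth[OF t] by simp
qed

lemma tangent_vector_const:
  assumes t: "t \<in> tangent_space A p"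
  shows "t (\<lambda>q. r) = 0"
proof -
  obtain U \<phi> where c: "(U, \<phi>) \<in> A" "p \<in> U" by (rule chart_around)
  then show ?thesis using t by (auto simp: tangent_space_chart[OF c] dir_deriv_def)
qed

text \<open>Both functions must be smooth near \<open>p\<close>: the default 0 is not additive,
  since two functions that are not smooth may have a smooth sum.\<close>

lemma tangent_vector_add:
  assumes t: "t \<in> tangent_space A p" and f: "smooth_near A p f" and h: "smooth_near A p h"
  shows "t (\<lambda>q. f q + h q) = t f + t h"
proof -
  obtain U \<phi> where c: "(U, \<phi>) \<in> A" "p \<in> U" by (rule chart_around)
  obtain a where a: "t = dir_deriv A (U, \<phi>) p a"
    using t by (auto simp: tangent_space_chart[OF c])
  obtain W where "p \<in> W" "smooth_fun_on A W f" "smooth_fun_on A W h"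
    using smooth_near2E[OF f h] .
  then have s: "smooth_near A p (\<lambda>q. f q + h q)"
    by (intro smooth_nearI[of W] smooth_fun_on_add)
  have "frechet_derivative (\<lambda>x. f (inv_into U \<phi> x) + h (inv_into U \<phi> x)) (at (\<phi> p))
    = (\<lambda>a. frechet_derivative (\<lambda>x. f (inv_into U \<phi> x)) (at (\<phi> p)) a
       + frechet_derivative (\<lambda>x. h (inv_into U \<phi> x)) (at (\<phi> p)) a)"
    using smooth_near_differentiable[OF f c] smooth_near_differentiable[OF h c]
    by (intro frechet_derivative_at[symmetric] has_derivative_add) (auto simp: frechet_derivative_works)
  then show ?thesis using s f h by (simp add: a dir_deriv_def)
qed

lemma tangent_vector_mult:
  assumes t: "t \<in> tangent_space A p" and f: "smooth_near A p f" and h: "smooth_near A p h"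
  shows "t (\<lambda>q. f q * h q) = t f * h p + f p * t h"
proof -
  obtain U \<phi> where c: "(U, \<phi>) \<in> A" "p \<in> U" by (rule chart_around)
  obtain a where a: "t = dir_deriv A (U, \<phi>) p a"
    using t by (auto simp: tangent_space_chart[OF c])
  obtain W where "p \<in> W" "smooth_fun_on A W f" "smooth_fun_on A W h"
    using smooth_near2E[OF f h] .
  then have s: "smooth_near A p (\<lambda>q. f q * h q)"
    by (intro smooth_nearI[of W] smooth_fun_on_mult)
  have "frechet_derivative (\<lambda>x. f (inv_into U \<phi> x) * h (inv_into U \<phi> x)) (at (\<phi> p))
    = (\<lambda>a. f (inv_into U \<phi> (\<phi> p)) * frechet_derivative (\<lambda>x. h (inv_into U \<phi> x)) (at (\<phi> p)) a
       + frechet_derivative (\<lambda>x. f (inv_into U \<phi> x)) (at (\<phi> p)) a * h (inv_into U \<phi> (\<phi> p)))"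
    using smooth_near_differentiable[OF f c] smooth_near_differentiable[OF h c]
    by (intro frechet_derivative_at[symmetric] has_derivative_mult) (auto simp: frechet_derivative_works)
  then show ?thesis using s f h c by (simp add: a dir_deriv_def)
qed

lemma vector_field_on_open: "vector_field_on A W X \<Longrightarrow> open W"
  and vector_field_on_tangent: "vector_field_on A W X \<Longrightarrow> p \<in> W \<Longrightarrow> X p \<in> tangent_space A p"
  by (simp_all add: vector_field_on_def)

lemma vector_field_on_smooth:
  assumes "vector_field_on A W X" "smooth_fun_on A W f"
  shows "smooth_fun_on A W (\<lambda>q. X q f)"
proof -
  have "smooth_fun_on A (W \<inter> W) (\<lambda>q. X q f)"
    using assms unfolding vector_field_on_def by blast
  then show ?thesis by simp
qed

lemma vector_field_on_transfer:
  assumes "vector_field_on A W X" "\<And>q. q \<in> W \<Longrightarrow> X q = Y q"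
  shows "vector_field_on A W Y"
  unfolding vector_field_on_def
proof (intro conjI allI impI ballI)
  show "open W" using assms by (auto simp: vector_field_on_def)
  show "Y p \<in> tangent_space A p" if "p \<in> W" for p
    using assms that by (auto simp: vector_field_on_def)
  show "smooth_fun_on A (W \<inter> V') (\<lambda>q. Y q f)" if "smooth_fun_on A V' f" for V' f
    by (rule smooth_fun_on_transfer[of _ "\<lambda>q. X q f"]) (use assms that in \<open>auto simp: vector_field_on_def\<close>)
qed

lemma vector_field_on_subset:
  assumes "vector_field_on A W X" "open W'" "W' \<subseteq> W"
  shows "vector_field_on A W' X"
  unfolding vector_field_on_def
proof (intro conjI allI impI ballI)
  show "open W'" by fact
  show "X p \<in> tangent_space A p" if "p \<in> W'" for p
    using assms that by (auto simp: vector_field_on_def)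
  show "smooth_fun_on A (W' \<inter> V') (\<lambda>q. X q f)" if "smooth_fun_on A V' f" for V' f
    by (rule smooth_fun_on_subset[of "W \<inter> V'"])
       (use assms that smooth_fun_on_open[OF that] in \<open>auto simp: vector_field_on_def\<close>)
qed

lemma vector_field_on_add:
  assumes X: "vector_field_on A W X" and Y: "vector_field_on A W Y"
  shows "vector_field_on A W (vf_add X Y)"
  using assms unfolding vector_field_on_def vf_add_def
  by (auto intro: tangent_space_add smooth_fun_on_add)

lemma vector_field_on_scale:
  assumes X: "vector_field_on A W X" and h: "smooth_fun_on A W h"
  shows "vector_field_on A W (vf_scale h X)"
  unfolding vector_field_on_def vf_scale_def
proof (intro conjI allI impI ballI)
  show "open W" using h by (rule smooth_fun_on_open)
  show "(\<lambda>f. h p * X p f) \<in> tangent_space A p" if "p \<in> W" for p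
    using X that by (auto simp: vector_field_on_def intro: tangent_space_scale)
  show "smooth_fun_on A (W \<inter> V') (\<lambda>q. h q * X q f)" if "smooth_fun_on A V' f" for V' f
    by (rule smooth_fun_on_mult)
       (use X h that smooth_fun_on_open[OF that] smooth_fun_on_open[OF h] in
         \<open>auto simp: vector_field_on_def intro: smooth_fun_on_subset\<close>)
qed

text \<open>In its own chart the field acts as a partial derivative on coordinate expressions, which
  preserves \<open>Cinf_on\<close>; the other charts are covered by
  \<open>smooth_fun_on_chartI\<close>.\<close>

lemma vector_field_on_coordinate:
  assumes c: "(U, \<phi>) \<in> A"
  shows "vector_field_on A U (\<lambda>q. dir_deriv A (U, \<phi>) q (axis i 1))"
  unfolding vector_field_on_def
proof (intro conjI allI impI ballI)
  show "open U" using c by (rule open_chart)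
  show "dir_deriv A (U, \<phi>) p (axis i 1) \<in> tangent_space A p" if "p \<in> U" for p
    by (simp add: tangent_space_chart[OF c that])
  fix V' f assume f: "smooth_fun_on A V' f"
  have o: "open (U \<inter> V')" using c f by (auto intro: open_chart smooth_fun_on_open)
  show "smooth_fun_on A (U \<inter> V') (\<lambda>q. dir_deriv A (U, \<phi>) q (axis i 1) f)"
  proof (rule smooth_fun_on_chartI[OF c o])
    have "Cinf_on (\<phi> ` (U \<inter> V')) (\<lambda>x. f (inv_into U \<phi> x))"
      using f c by (auto simp: smooth_fun_on_def)
    from Cinf_on_derivative[OF this]
    have *: "Ck_on k (\<lambda>x. frechet_derivative (\<lambda>x. f (inv_into U \<phi> x)) (at x) (axis i 1))
      (\<phi> ` (U \<inter> V'))" for k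
      by (simp add: Cinf_on_def)
    have "Ck_on k (\<lambda>x. dir_deriv A (U, \<phi>) (inv_into U \<phi> x) (axis i 1) f) (\<phi> ` (U \<inter> V'))" for k
    proof (rule Ck_on_transfer[OF open_chart_image[OF c smooth_fun_on_open[OF f]] *])
      fix x assume "x \<in> \<phi> ` (U \<inter> V')"
      then obtain q where q: "q \<in> U" "q \<in> V'" "x = \<phi> q" by auto
      show "dir_deriv A (U, \<phi>) (inv_into U \<phi> x) (axis i 1) f
          = frechet_derivative (\<lambda>x. f (inv_into U \<phi> x)) (at x) (axis i 1)"
        using smooth_nearI[OF f q(2)] q c by (simp add: dir_deriv_def)
    qed
    then show "Cinf_on (\<phi> ` (U \<inter> V')) (\<lambda>x. dir_deriv A (U, \<phi>) (inv_into U \<phi> x) (axis i 1) f)"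
      by (simp add: Cinf_on_def)
  qed simp
qed

end

section \<open>Algebraic Riemannian geometry\<close>

text \<open>The calculus of the Levi-Civita connection is done over a commutative ring \<open>F\<close> with unit \<open>e\<close>,
  to be instantiated by the smooth functions on an open set \<open>W\<close>, and an \<open>F\<close>-module \<open>V\<close>, the vector
  fields on \<open>W\<close>. Functions and fields are normalised to vanish outside of \<open>W\<close>, so that agreement on \<open>W\<close>
  is equality; this is why \<open>e\<close>, the indicator function of \<open>W\<close>, is not the unit of the ambient
  ring.\<close>

locale levi_civita_algebra =
  fixes F :: "'f::comm_ring set" and V :: "'v::ab_group_add set"
    and e :: 'f
    and sc :: "'f \<Rightarrow> 'v \<Rightarrow> 'v" (infixr "\<cdot>" 75)
    and act :: "'v \<Rightarrow> 'f \<Rightarrow> 'f"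
    and D :: "'v \<Rightarrow> 'v \<Rightarrow> 'v"
    and G :: "'v \<Rightarrow> 'v \<Rightarrow> 'f"
  assumes F_zero [simp]: "0 \<in> F" and F_unit [simp]: "e \<in> F"
    and F_add [simp]: "a \<in> F \<Longrightarrow> b \<in> F \<Longrightarrow> a + b \<in> F"
    and F_uminus [simp]: "a \<in> F \<Longrightarrow> - a \<in> F"
    and F_mult [simp]: "a \<in> F \<Longrightarrow> b \<in> F \<Longrightarrow> a * b \<in> F"
    and unit_mult [simp]: "a \<in> F \<Longrightarrow> e * a = a"
    and V_zero [simp]: "0 \<in> V"
    and V_add [simp]: "X \<in> V \<Longrightarrow> Y \<in> V \<Longrightarrow> X + Y \<in> V"
    and V_uminus [simp]: "X \<in> V \<Longrightarrow> - X \<in> V"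
    and V_scale [simp]: "a \<in> F \<Longrightarrow> X \<in> V \<Longrightarrow> a \<cdot> X \<in> V"
    and scale_add_right [simp]: "a \<in> F \<Longrightarrow> X \<in> V \<Longrightarrow> Y \<in> V \<Longrightarrow> a \<cdot> (X + Y) = a \<cdot> X + a \<cdot> Y"
    and scale_add_left [simp]: "a \<in> F \<Longrightarrow> b \<in> F \<Longrightarrow> X \<in> V \<Longrightarrow> (a + b) \<cdot> X = a \<cdot> X + b \<cdot> X"
    and scale_scale [simp]: "a \<in> F \<Longrightarrow> b \<in> F \<Longrightarrow> X \<in> V \<Longrightarrow> a \<cdot> b \<cdot> X = (a * b) \<cdot> X"
    and act_F [simp]: "X \<in> V \<Longrightarrow> a \<in> F \<Longrightarrow> act X a \<in> F"
    and act_add [simp]: "X \<in> V \<Longrightarrow> a \<in> F \<Longrightarrow> b \<in> F \<Longrightarrow> act X (a + b) = act X a + act X b"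
    and act_mult [simp]: "X \<in> V \<Longrightarrow> a \<in> F \<Longrightarrow> b \<in> F \<Longrightarrow> act X (a * b) = act X a * b + a * act X b"
    and act_add_left [simp]: "X \<in> V \<Longrightarrow> Y \<in> V \<Longrightarrow> a \<in> F \<Longrightarrow> act (X + Y) a = act X a + act Y a"
    and act_faithful: "X \<in> V \<Longrightarrow> (\<And>a. a \<in> F \<Longrightarrow> act X a = 0) \<Longrightarrow> X = 0"
    and D_V [simp]: "X \<in> V \<Longrightarrow> Y \<in> V \<Longrightarrow> D X Y \<in> V"
    and D_add_left [simp]: "X \<in> V \<Longrightarrow> Y \<in> V \<Longrightarrow> Z \<in> V \<Longrightarrow> D (X + Y) Z = D X Z + D Y Z"
    and D_scale_left [simp]: "a \<in> F \<Longrightarrow> X \<in> V \<Longrightarrow> Y \<in> V \<Longrightarrow> D (a \<cdot> X) Y = a \<cdot> D X Y"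
    and D_add_right [simp]: "X \<in> V \<Longrightarrow> Y \<in> V \<Longrightarrow> Z \<in> V \<Longrightarrow> D X (Y + Z) = D X Y + D X Z"
    and D_scale_right [simp]: "a \<in> F \<Longrightarrow> X \<in> V \<Longrightarrow> Y \<in> V \<Longrightarrow>
      D X (a \<cdot> Y) = act X a \<cdot> Y + a \<cdot> D X Y"
    and torsion_free: "X \<in> V \<Longrightarrow> Y \<in> V \<Longrightarrow> a \<in> F \<Longrightarrow>
      act (D X Y) a - act (D Y X) a = act X (act Y a) - act Y (act X a)"
    and G_F [simp]: "X \<in> V \<Longrightarrow> Y \<in> V \<Longrightarrow> G X Y \<in> F"
    and G_commute: "X \<in> V \<Longrightarrow> Y \<in> V \<Longrightarrow> G X Y = G Y X"
    and G_add_left [simp]: "X \<in> V \<Longrightarrow> Y \<in> V \<Longrightarrow> Z \<in> V \<Longrightarrow> G (X + Y) Z = G X Z + G Y Z"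
    and G_scale_left [simp]: "a \<in> F \<Longrightarrow> X \<in> V \<Longrightarrow> Y \<in> V \<Longrightarrow> G (a \<cdot> X) Y = a * G X Y"
    and act_G [simp]: "X \<in> V \<Longrightarrow> Y \<in> V \<Longrightarrow> Z \<in> V \<Longrightarrow> act X (G Y Z) = G (D X Y) Z + G Y (D X Z)"
begin

lemma G_add_right [simp]: "X \<in> V \<Longrightarrow> Y \<in> V \<Longrightarrow> Z \<in> V \<Longrightarrow> G X (Y + Z) = G X Y + G X Z"
  by (metis G_add_left G_commute V_add)

lemma G_scale_right [simp]: "a \<in> F \<Longrightarrow> X \<in> V \<Longrightarrow> Y \<in> V \<Longrightarrow> G X (a \<cdot> Y) = a * G X Y"
  by (metis G_scale_left G_commute V_scale)

lemma F_diff [simp]: "a \<in> F \<Longrightarrow> b \<in> F \<Longrightarrow> a - b \<in> F"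
  using F_add[of a "- b"] by simp

lemma V_diff [simp]: "X \<in> V \<Longrightarrow> Y \<in> V \<Longrightarrow> X - Y \<in> V"
  using V_add[of X "- Y"] by simp

lemma scale_zero_left [simp]: "X \<in> V \<Longrightarrow> 0 \<cdot> X = 0"
  using scale_add_left[of 0 0 X] by simp

lemma scale_zero_right [simp]: "a \<in> F \<Longrightarrow> a \<cdot> 0 = 0"
  using scale_add_right[of a 0 0] by simp

lemma scale_uminus_left [simp]: "a \<in> F \<Longrightarrow> X \<in> V \<Longrightarrow> (- a) \<cdot> X = - (a \<cdot> X)"
  using scale_add_left[of a "- a" X] by (simp add: add_eq_0_iff)

lemma scale_uminus_right [simp]: "a \<in> F \<Longrightarrow> X \<in> V \<Longrightarrow> a \<cdot> (- X) = - (a \<cdot> X)"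
  using scale_add_right[of a X "- X"] by (simp add: add_eq_0_iff)

lemma scale_diff_left [simp]: "a \<in> F \<Longrightarrow> b \<in> F \<Longrightarrow> X \<in> V \<Longrightarrow> (a - b) \<cdot> X = a \<cdot> X - b \<cdot> X"
  using scale_add_left[of a "- b" X] by simp

lemma scale_diff_right [simp]: "a \<in> F \<Longrightarrow> X \<in> V \<Longrightarrow> Y \<in> V \<Longrightarrow> a \<cdot> (X - Y) = a \<cdot> X - a \<cdot> Y"
  using scale_add_right[of a X "- Y"] by simp

lemma act_zero [simp]: "X \<in> V \<Longrightarrow> act X 0 = 0"
  using act_add[of X 0 0] by simp

lemma act_zero_left [simp]: "a \<in> F \<Longrightarrow> act 0 a = 0"
  using act_add_left[of 0 0 a] by simp

lemma act_uminus [simp]: "X \<in> V \<Longrightarrow> a \<in> F \<Longrightarrow> act X (- a) = - act X a"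
  using act_add[of X a "- a"] by (simp add: add_eq_0_iff)

lemma act_uminus_left [simp]: "X \<in> V \<Longrightarrow> a \<in> F \<Longrightarrow> act (- X) a = - act X a"
  using act_add_left[of X "- X" a] by (simp add: add_eq_0_iff)

lemma act_diff [simp]: "X \<in> V \<Longrightarrow> a \<in> F \<Longrightarrow> b \<in> F \<Longrightarrow> act X (a - b) = act X a - act X b"
  using act_add[of X a "- b"] by simp

lemma act_diff_left [simp]: "X \<in> V \<Longrightarrow> Y \<in> V \<Longrightarrow> a \<in> F \<Longrightarrow> act (X - Y) a = act X a - act Y a"
  using act_add_left[of X "- Y" a] by simp

lemma D_zero_left [simp]: "Y \<in> V \<Longrightarrow> D 0 Y = 0"
  using D_add_left[of 0 0 Y] by simp

lemma D_zero_right [simp]: "X \<in> V \<Longrightarrow> D X 0 = 0"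
  using D_add_right[of X 0 0] by simp

lemma D_uminus_left [simp]: "X \<in> V \<Longrightarrow> Y \<in> V \<Longrightarrow> D (- X) Y = - D X Y"
  using D_add_left[of X "- X" Y] by (simp add: add_eq_0_iff)

lemma D_uminus_right [simp]: "X \<in> V \<Longrightarrow> Y \<in> V \<Longrightarrow> D X (- Y) = - D X Y"
  using D_add_right[of X Y "- Y"] by (simp add: add_eq_0_iff)

lemma D_diff_left [simp]: "X \<in> V \<Longrightarrow> Y \<in> V \<Longrightarrow> Z \<in> V \<Longrightarrow> D (X - Y) Z = D X Z - D Y Z"
  using D_add_left[of X "- Y" Z] by simp

lemma D_diff_right [simp]: "X \<in> V \<Longrightarrow> Y \<in> V \<Longrightarrow> Z \<in> V \<Longrightarrow> D X (Y - Z) = D X Y - D X Z"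
  using D_add_right[of X Y "- Z"] by simp

lemma G_zero_left [simp]: "Y \<in> V \<Longrightarrow> G 0 Y = 0"
  using G_add_left[of 0 0 Y] by simp

lemma G_zero_right [simp]: "Y \<in> V \<Longrightarrow> G Y 0 = 0"
  using G_add_right[of Y 0 0] by simp

lemma G_uminus_left [simp]: "X \<in> V \<Longrightarrow> Y \<in> V \<Longrightarrow> G (- X) Y = - G X Y"
  using G_add_left[of X "- X" Y] by (simp add: add_eq_0_iff)

lemma G_uminus_right [simp]: "X \<in> V \<Longrightarrow> Y \<in> V \<Longrightarrow> G X (- Y) = - G X Y"
  using G_add_right[of X Y "- Y"] by (simp add: add_eq_0_iff)

lemma G_diff_left [simp]: "X \<in> V \<Longrightarrow> Y \<in> V \<Longrightarrow> Z \<in> V \<Longrightarrow> G (X - Y) Z = G X Z - G Y Z"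
  using G_add_left[of X "- Y" Z] by simp

lemma G_diff_right [simp]: "X \<in> V \<Longrightarrow> Y \<in> V \<Longrightarrow> Z \<in> V \<Longrightarrow> G X (Y - Z) = G X Y - G X Z"
  using G_add_right[of X Y "- Z"] by simp

lemma F_sum [simp]: "(\<And>i. i \<in> I \<Longrightarrow> a i \<in> F) \<Longrightarrow> sum a I \<in> F"
  by (induction I rule: infinite_finite_induct) auto

lemma V_sum [simp]: "(\<And>i. i \<in> I \<Longrightarrow> X i \<in> V) \<Longrightarrow> sum X I \<in> V"
  by (induction I rule: infinite_finite_induct) auto

lemma act_sum [simp]: "X \<in> V \<Longrightarrow> (\<And>i. i \<in> I \<Longrightarrow> a i \<in> F) \<Longrightarrow> act X (sum a I) = (\<Sum>i\<in>I. act X (a i))"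
  by (induction I rule: infinite_finite_induct) auto

lemma mult_unit [simp]: "a \<in> F \<Longrightarrow> a * e = a"
  using unit_mult by (simp add: mult.commute)

lemma act_unit [simp]:
  assumes "X \<in> V"
  shows "act X e = 0"
  using act_mult[of X e e] assms by simp

text \<open>The second covariant derivative of \<open>Z\<close>; the correction term makes it linear
  over \<open>F\<close> in both \<open>X\<close> and \<open>Y\<close>.\<close>

definition D2 :: "'v \<Rightarrow> 'v \<Rightarrow> 'v \<Rightarrow> 'v" where
  "D2 X Y Z = D X (D Y Z) - D (D X Y) Z"

text \<open>The curvature, with the Lie bracket written as \<open>D X Y - D Y X\<close>: the
  algebraic model has no bracket of its own.\<close>

definition R :: "'v \<Rightarrow> 'v \<Rightarrow> 'v \<Rightarrow> 'v" where
  "R X Y Z = D X (D Y Z) - D Y (D X Z) - D (D X Y - D Y X) Z"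

text \<open>The covariant derivative of the curvature tensor in direction \<open>U\<close>.\<close>

definition DR :: "'v \<Rightarrow> 'v \<Rightarrow> 'v \<Rightarrow> 'v \<Rightarrow> 'v" where
  "DR U X Y Z = D U (R X Y Z) - R (D U X) Y Z - R X (D U Y) Z - R X Y (D U Z)"

lemma D2_V [simp]: "X \<in> V \<Longrightarrow> Y \<in> V \<Longrightarrow> Z \<in> V \<Longrightarrow> D2 X Y Z \<in> V"
  by (simp add: D2_def)

lemma R_V [simp]: "X \<in> V \<Longrightarrow> Y \<in> V \<Longrightarrow> Z \<in> V \<Longrightarrow> R X Y Z \<in> V"
  by (simp add: R_def)

lemma DR_V [simp]: "U \<in> V \<Longrightarrow> X \<in> V \<Longrightarrow> Y \<in> V \<Longrightarrow> Z \<in> V \<Longrightarrow> DR U X Y Z \<in> V"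
  by (simp add: DR_def)

lemma R_eq_D2: "X \<in> V \<Longrightarrow> Y \<in> V \<Longrightarrow> Z \<in> V \<Longrightarrow> R X Y Z = D2 X Y Z - D2 Y X Z"
  by (simp add: R_def D2_def)

text \<open>By torsion-freeness \<open>B X Y\<close> acts on functions as a commutator, for which
  the identity is formal; \<open>act_faithful\<close> lifts it from the action to the
  fields.\<close>

lemma jacobi:
  assumes "X \<in> V" "Y \<in> V" "Z \<in> V"
  defines "B \<equiv> \<lambda>X Y. D X Y - D Y X"
  shows "B X (B Y Z) + B Y (B Z X) + B Z (B X Y) = 0"
proof (rule act_faithful)
  have B: "act (B X Y) a = act X (act Y a) - act Y (act X a)" if "X \<in> V" "Y \<in> V" "a \<in> F" for X Y a
    using that torsion_free by (simp add: B_def)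
  have BV: "B X Y \<in> V" if "X \<in> V" "Y \<in> V" for X Y
    using that by (simp add: B_def)
  show "act (B X (B Y Z) + B Y (B Z X) + B Z (B X Y)) a = 0" if "a \<in> F" for a
    using assms(1-3) that by (simp add: B BV)
  show "B X (B Y Z) + B Y (B Z X) + B Z (B X Y) \<in> V"
    using assms(1-3) by (simp add: BV)
qed

text \<open>In the cyclic sum all iterated covariant derivatives cancel. What survives is the
  derivative of \<open>U\<close> along the cyclic sum of double brackets, which is zero by
  \<open>jacobi\<close>.\<close>

lemma second_bianchi:
  assumes [simp]: "X \<in> V" "Y \<in> V" "Z \<in> V" "U \<in> V"
  shows "DR X Y Z U + DR Y Z X U + DR Z X Y U = 0"
proof -
  have "D ((D X (D Y Z - D Z Y) - D (D Y Z - D Z Y) X) + (D Y (D Z X - D X Z) - D (D Z X - D X Z) Y)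
    + (D Z (D X Y - D Y X) - D (D X Y - D Y X) Z)) U = 0"
    by (simp only: jacobi[OF assms(1-3)] D_zero_left[OF assms(4)])
  then show ?thesis
    by (simp add: DR_def R_def algebra_simps)
qed

lemma R_skew: "X \<in> V \<Longrightarrow> Y \<in> V \<Longrightarrow> Z \<in> V \<Longrightarrow> R X Y Z = - R Y X Z"
  by (simp add: R_def)

lemma DR_skew: "U \<in> V \<Longrightarrow> X \<in> V \<Longrightarrow> Y \<in> V \<Longrightarrow> Z \<in> V \<Longrightarrow> DR U X Y Z = - DR U Y X Z"
  by (simp add: DR_def R_def algebra_simps)

text \<open>Two derivatives of the function \<open>G Z U\<close> commute up to the bracket. Expanded
  by metric compatibility, the mixed terms cancel and the curvature terms remain.\<close>

lemma G_R_skew: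
  assumes [simp]: "X \<in> V" "Y \<in> V" "Z \<in> V" "U \<in> V"
  shows "G (R X Y Z) U = - G (R X Y U) Z"
proof -
  have "act (D X Y) (G Z U) - act (D Y X) (G Z U) = act X (act Y (G Z U)) - act Y (act X (G Z U))"
    by (rule torsion_free) auto
  then show ?thesis
    by (simp add: G_commute[of "R X Y U" Z]) (simp add: R_def algebra_simps)
qed

lemma act_G_R:
  assumes [simp]: "W \<in> V" "X \<in> V" "Y \<in> V" "Z \<in> V" "U \<in> V"
  shows "act W (G (R X Y Z) U) = G (DR W X Y Z) U + G (R (D W X) Y Z) U + G (R X (D W Y) Z) U
    + G (R X Y (D W Z)) U + G (R X Y Z) (D W U)"
  by (simp add: DR_def)

lemma G_DR_skew:
  assumes [simp]: "W \<in> V" "X \<in> V" "Y \<in> V" "Z \<in> V" "U \<in> V"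
  shows "G (DR W X Y Z) U = - G (DR W X Y U) Z"
proof -
  have "act W (G (R X Y Z) U) = - act W (G (R X Y U) Z)"
    by (subst G_R_skew) (auto simp del: act_G)
  then show ?thesis
    unfolding act_G_R[OF assms] act_G_R[OF assms(1-3,5,4)]
    using G_R_skew[of "D W X" Y Z U] G_R_skew[of X "D W Y" Z U] G_R_skew[of X Y "D W Z" U]
      G_R_skew[of X Y Z "D W U"]
    by (simp add: algebra_simps)
qed

lemma R_scale1:
  assumes [simp]: "a \<in> F" "X \<in> V" "Y \<in> V" "Z \<in> V"
  shows "R (a \<cdot> X) Y Z = a \<cdot> R X Y Z"
  by (simp add: R_def algebra_simps)

lemma R_scale2:
  assumes [simp]: "a \<in> F" "X \<in> V" "Y \<in> V" "Z \<in> V"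
  shows "R X (a \<cdot> Y) Z = a \<cdot> R X Y Z"
  using R_scale1[of a Y X Z] by (simp add: R_skew[of X])

text \<open>Here second derivatives of \<open>a\<close> appear; their commutator is the derivative
  of \<open>a\<close> along the bracket, which the last term of \<open>R\<close> removes.\<close>

lemma R_scale3:
  assumes [simp]: "a \<in> F" "X \<in> V" "Y \<in> V" "Z \<in> V"
  shows "R X Y (a \<cdot> Z) = a \<cdot> R X Y Z"
proof -
  have "(act (D X Y) a - act (D Y X) a) \<cdot> Z = (act X (act Y a) - act Y (act X a)) \<cdot> Z"
    by (simp only: torsion_free assms)
  then show ?thesis by (simp add: R_def algebra_simps)
qed

text \<open>Torsion-freeness applied to the potential \<open>f\<close>: after metric compatibility
  the terms with \<open>D X Y\<close> and \<open>D Y X\<close> drop out and the two Hessian terms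
  are left.\<close>

lemma gradient_hess_sym:
  assumes [simp]: "\<xi> \<in> V" "f \<in> F" "X \<in> V" "Y \<in> V"
    and f: "\<And>X. X \<in> V \<Longrightarrow> act X f = G \<xi> X"
  shows "G (D X \<xi>) Y = G (D Y \<xi>) X"
  using torsion_free[of X Y f] by (simp add: f)

definition bilinear_form :: "('v \<Rightarrow> 'v \<Rightarrow> 'f) \<Rightarrow> bool" where
  "bilinear_form b \<longleftrightarrow> (\<forall>X\<in>V. \<forall>Y\<in>V. b X Y \<in> F \<and>
     (\<forall>Z\<in>V. b (X + Z) Y = b X Y + b Z Y \<and> b X (Y + Z) = b X Y + b X Z) \<and>
     (\<forall>a\<in>F. b (a \<cdot> X) Y = a * b X Y \<and> b X (a \<cdot> Y) = a * b X Y))"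

lemma bilinear_form_sum_left:
  assumes b: "bilinear_form b" and "Y \<in> V" "\<And>i. i \<in> I \<Longrightarrow> a i \<in> F" "\<And>i. i \<in> I \<Longrightarrow> X i \<in> V"
  shows "b (\<Sum>i\<in>I. a i \<cdot> X i) Y = (\<Sum>i\<in>I. a i * b (X i) Y)"
proof -
  \<comment> \<open>Homogeneity with the scalar 0 gives the value at the zero field, the base of the
    induction.\<close>
  have "b (0 \<cdot> 0) Y = 0"
    using b \<open>Y \<in> V\<close> unfolding bilinear_form_def by (metis F_zero V_zero mult_zero_left)
  then have "b 0 Y = 0" by simp
  with assms show ?thesis
    by (induction I rule: infinite_finite_induct) (auto simp: bilinear_form_def)
qed

lemma bilinear_form_sum_right:
  assumes b: "bilinear_form b" and "Y \<in> V" "\<And>i. i \<in> I \<Longrightarrow> a i \<in> F" "\<And>i. i \<in> I \<Longrightarrow> X i \<in> V"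
  shows "b Y (\<Sum>i\<in>I. a i \<cdot> X i) = (\<Sum>i\<in>I. a i * b Y (X i))"
proof -
  have "bilinear_form (\<lambda>X Y. b Y X)" using b by (simp add: bilinear_form_def)
  from bilinear_form_sum_left[OF this assms(2), of I a X] assms(3,4) show ?thesis by simp
qed

lemma bilinear_form_G: "bilinear_form G"
  by (simp add: bilinear_form_def)

lemma bilinear_form_G_D: "X \<in> V \<Longrightarrow> bilinear_form (\<lambda>Y Z. G (D Y X) Z)"
  by (simp add: bilinear_form_def)

lemma bilinear_form_G_R:
  assumes [simp]: "Y \<in> V" "Z \<in> V"
  shows "bilinear_form (\<lambda>X U. G (R X Y Z) U)"
  by (simp add: bilinear_form_def R_scale1) (simp add: R_def algebra_simps)

text \<open>Spanning is part of the definition, because over a ring it cannot be obtained from a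
  dimension count; on the manifold it is proved pointwise in \<open>frame_expand\<close>.\<close>

definition orthonormal_frame :: "('n::finite \<Rightarrow> 'v) \<Rightarrow> bool" where
  "orthonormal_frame E \<longleftrightarrow> (\<forall>i. E i \<in> V) \<and> (\<forall>i j. G (E i) (E j) = (if i = j then e else 0)) \<and>
     (\<forall>X\<in>V. X = (\<Sum>i\<in>UNIV. G X (E i) \<cdot> E i))"

lemma orthonormal_frameD:
  assumes "orthonormal_frame E"
  shows "E i \<in> V" "G (E i) (E j) = (if i = j then e else 0)"
    "X \<in> V \<Longrightarrow> X = (\<Sum>i\<in>UNIV. G X (E i) \<cdot> E i)"
  using assms by (auto simp: orthonormal_frame_def)

lemma bilinear_form_expand_left:
  assumes E: "orthonormal_frame E" and b: "bilinear_form b" and "X \<in> V" "Y \<in> V"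
  shows "b X Y = (\<Sum>i\<in>UNIV. G X (E i) * b (E i) Y)"
  using bilinear_form_sum_left[OF b \<open>Y \<in> V\<close>, of UNIV "\<lambda>i. G X (E i)" E]
    orthonormal_frameD(3)[OF E \<open>X \<in> V\<close>] \<open>X \<in> V\<close> orthonormal_frameD(1)[OF E] by simp

lemma bilinear_form_expand_right:
  assumes E: "orthonormal_frame E" and b: "bilinear_form b" and "X \<in> V" "Y \<in> V"
  shows "b X Y = (\<Sum>i\<in>UNIV. G Y (E i) * b X (E i))"
  using bilinear_form_sum_right[OF b \<open>X \<in> V\<close>, of UNIV "\<lambda>i. G Y (E i)" E]
    orthonormal_frameD(3)[OF E \<open>Y \<in> V\<close>] \<open>Y \<in> V\<close> orthonormal_frameD(1)[OF E] by simp

text \<open>Expanding one argument in \<open>E\<close>, exchanging the sums, and contracting the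
  other argument in \<open>E'\<close> passes from one trace to the other.\<close>

lemma trace_frame_independent:
  assumes E: "orthonormal_frame E" and E': "orthonormal_frame E'" and b: "bilinear_form b"
  shows "(\<Sum>i\<in>UNIV. b (E i) (E i)) = (\<Sum>i\<in>UNIV. b (E' i) (E' i))"
proof -
  note [simp] = orthonormal_frameD(1)[OF E] orthonormal_frameD(1)[OF E']
  have "(\<Sum>i\<in>UNIV. b (E' i) (E' i)) = (\<Sum>i\<in>UNIV. \<Sum>j\<in>UNIV. G (E' i) (E j) * b (E j) (E' i))"
    by (intro sum.cong refl bilinear_form_expand_left[OF E b]) auto
  also have "\<dots> = (\<Sum>j\<in>UNIV. \<Sum>i\<in>UNIV. G (E j) (E' i) * b (E j) (E' i))"
    by (subst sum.swap) (simp add: G_commute[of "E' _" "E _"])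
  also have "\<dots> = (\<Sum>j\<in>UNIV. b (E j) (E j))"
    by (intro sum.cong refl bilinear_form_expand_right[OF E' b, symmetric]) auto
  finally show ?thesis ..
qed

text \<open>The connection form of an orthonormal frame is skew-symmetric, so it does not contribute to
  the derivative of a trace.\<close>

lemma act_trace:
  assumes E: "orthonormal_frame E" and b: "bilinear_form b" and [simp]: "U \<in> V"
  shows "act U (\<Sum>i\<in>UNIV. b (E i) (E i))
    = (\<Sum>i\<in>UNIV. act U (b (E i) (E i)) - b (D U (E i)) (E i) - b (E i) (D U (E i)))"
proof -
  note [simp] = orthonormal_frameD(1)[OF E]
  have [simp]: "b X Y \<in> F" if "X \<in> V" "Y \<in> V" for X Y
    using b that by (simp add: bilinear_form_def)
  define \<omega> where "\<omega> i j = G (D U (E i)) (E j)" for i j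
  have \<omega>: "\<omega> j i = - \<omega> i j" for i j
  proof -
    \<comment> \<open>The product is \<open>e\<close> or 0, and both have derivative 0; metric
      compatibility turns this into skew-symmetry of \<open>\<omega>\<close>.\<close>
    have "act U (G (E i) (E j)) = 0"
      by (subst orthonormal_frameD(2)[OF E]) auto
    then show ?thesis
      by (simp add: \<omega>_def eq_neg_iff_add_eq_0 add.commute G_commute[of "E i" "D U (E j)"])
  qed
  have "(\<Sum>i\<in>UNIV. b (D U (E i)) (E i)) = (\<Sum>i\<in>UNIV. \<Sum>j\<in>UNIV. \<omega> i j * b (E j) (E i))"
    unfolding \<omega>_def by (intro sum.cong refl bilinear_form_expand_left[OF E b]) auto
  \<comment> \<open>Renaming the indices brings both correction sums to the same form
    \<open>b (E i) (E j)\<close>, with opposite signs by skew-symmetry.\<close>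
  also have "\<dots> = (\<Sum>i\<in>UNIV. \<Sum>j\<in>UNIV. \<omega> j i * b (E i) (E j))"
    by (rule sum.swap)
  also have "\<dots> = - (\<Sum>i\<in>UNIV. \<Sum>j\<in>UNIV. \<omega> i j * b (E i) (E j))"
    by (subst \<omega>) (simp add: sum_negf)
  also have "(\<Sum>i\<in>UNIV. \<Sum>j\<in>UNIV. \<omega> i j * b (E i) (E j)) = (\<Sum>i\<in>UNIV. b (E i) (D U (E i)))"
    unfolding \<omega>_def by (intro sum.cong refl bilinear_form_expand_right[OF E b, symmetric]) auto
  finally show ?thesis
    by (simp add: sum_subtractf)
qed

end

section \<open>Traces in an orthonormal frame: Ricci tensor, divergence, Laplacians\<close>

locale levi_civita_frame = levi_civita_algebra F V e sc act D G
  for F :: "'f::comm_ring set" and V :: "'v::ab_group_add set" and e sc act D G +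
  fixes E :: "'n::finite \<Rightarrow> 'v"
  assumes frame: "orthonormal_frame E"
begin

lemmas E_V [simp] = orthonormal_frameD(1)[OF frame]
lemmas G_E = orthonormal_frameD(2)[OF frame]

lemma parseval: "X \<in> V \<Longrightarrow> Y \<in> V \<Longrightarrow> (\<Sum>i\<in>UNIV. G X (E i) * G Y (E i)) = G X Y"
  using bilinear_form_expand_right[OF frame bilinear_form_G, of X Y] by (simp add: mult.commute)

definition Ric :: "'v \<Rightarrow> 'v \<Rightarrow> 'f" where
  "Ric Y Z = (\<Sum>i\<in>UNIV. G (R (E i) Y Z) (E i))"

definition dvg :: "'v \<Rightarrow> 'f" where
  "dvg X = (\<Sum>i\<in>UNIV. G (D (E i) X) (E i))"

definition lap :: "'f \<Rightarrow> 'f" where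
  "lap u = (\<Sum>i\<in>UNIV. act (E i) (act (E i) u) - act (D (E i) (E i)) u)"

lemma Ric_F [simp]: "X \<in> V \<Longrightarrow> Y \<in> V \<Longrightarrow> Ric X Y \<in> F"
  by (simp add: Ric_def)

lemma dvg_F [simp]: "X \<in> V \<Longrightarrow> dvg X \<in> F"
  by (simp add: dvg_def)

lemma bilinear_form_Ric: "bilinear_form Ric"
  unfolding bilinear_form_def Ric_def
  by (auto simp: R_scale2 R_scale3 sum_distrib_left simp flip: sum.distrib)
     (auto intro!: sum.cong simp: R_def algebra_simps)

text \<open>The divergence is the trace of the tensor \<open>G (D Y X) Z\<close>; differentiating a
  trace gives the trace of the covariant derivative, which is \<open>D2\<close>.\<close>

lemma act_dvg:
  assumes [simp]: "X \<in> V" "U \<in> V"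
  shows "act U (dvg X) = (\<Sum>i\<in>UNIV. G (D2 U (E i) X) (E i))"
  unfolding dvg_def act_trace[OF frame bilinear_form_G_D[OF assms(1)] assms(2)]
  by (intro sum.cong) (auto simp: D2_def)

lemma act_Ric:
  assumes [simp]: "U \<in> V" "Y \<in> V" "Z \<in> V"
  shows "act U (Ric Y Z) - Ric (D U Y) Z - Ric Y (D U Z) = (\<Sum>i\<in>UNIV. G (DR U (E i) Y Z) (E i))"
  unfolding Ric_def act_trace[OF frame bilinear_form_G_R[OF assms(2,3)] assms(1)]
  by (simp add: DR_def algebra_simps flip: sum_subtractf)

lemma act_scalar_curvature:
  assumes [simp]: "U \<in> V"
  shows "act U (\<Sum>j\<in>UNIV. Ric (E j) (E j)) = (\<Sum>j\<in>UNIV. \<Sum>i\<in>UNIV. G (DR U (E i) (E j) (E j)) (E i))"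
  unfolding act_trace[OF frame bilinear_form_Ric assms] act_Ric[OF assms E_V E_V] ..

text \<open>The double trace of the second Bianchi identity. Both remaining terms are divergences of
  the Ricci tensor: one after exchanging the last pair of slots (\<open>G_DR_skew\<close>) and the
  summation indices, the other after exchanging the first pair (\<open>DR_skew\<close>). Doubling is
  written as a sum, here and below, since \<open>'f\<close> is a ring without a unit and has no
  numerals.\<close>

lemma contracted_bianchi:
  assumes [simp]: "Y \<in> V"
  defines "dRic \<equiv> \<Sum>j\<in>UNIV. act (E j) (Ric Y (E j)) - Ric (D (E j) Y) (E j) - Ric Y (D (E j) (E j))"
  shows "act Y (\<Sum>j\<in>UNIV. Ric (E j) (E j)) = dRic + dRic"
proof -
  have d: "dRic = (\<Sum>j\<in>UNIV. \<Sum>i\<in>UNIV. G (DR (E j) (E i) Y (E j)) (E i))"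
    by (simp add: dRic_def act_Ric)
  have "G (DR Y (E i) (E j) (E j)) (E i)
    = G (DR (E i) (E j) Y (E i)) (E j) + G (DR (E j) (E i) Y (E j)) (E i)" for i j
  proof -
    have "DR Y (E i) (E j) (E j) + DR (E i) (E j) Y (E j) + DR (E j) Y (E i) (E j) = 0"
      by (rule second_bianchi) auto
    then have "G (DR Y (E i) (E j) (E j) + DR (E i) (E j) Y (E j) + DR (E j) Y (E i) (E j)) (E i) = 0"
      by simp
    then show ?thesis
      using G_DR_skew[of "E i" "E j" Y "E j" "E i"] DR_skew[of "E j" Y "E i" "E j"]
      by (simp add: algebra_simps add_eq_0_iff)
  qed
  then show ?thesis
    unfolding act_scalar_curvature[OF assms(1)]
    by (simp add: sum.distrib d) (rule sum.swap)
qed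

text \<open>The Leibniz rule applied twice. The cross terms are products of first derivatives, which
  \<open>parseval\<close> spreads into the double sum \<open>m\<close>, the inner product of the
  covariant differentials.\<close>

lemma lap_G:
  assumes [simp]: "X \<in> V" "Y \<in> V"
  defines "m \<equiv> \<Sum>i\<in>UNIV. \<Sum>j\<in>UNIV. G (D (E i) X) (E j) * G (D (E i) Y) (E j)"
  shows "lap (G X Y) = (\<Sum>i\<in>UNIV. G (D2 (E i) (E i) X) Y) + m + m + (\<Sum>i\<in>UNIV. G (D2 (E i) (E i) Y) X)"
  unfolding lap_def m_def
  by (simp add: parseval D2_def algebra_simps G_commute[of "D (D (E _) (E _)) Y" X] G_commute[of "D (E _) (D (E _) Y)" X]
     flip: sum.distrib)

text \<open>1-forms are represented by their dual fields: \<open>ext_d X\<close> and \<open>hodge X\<close> stand for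
  \<open>d\<alpha>\<close> and \<open>\<Delta>\<alpha>\<close> with \<open>\<alpha> = G X\<close>.\<close>

definition ext_d :: "'v \<Rightarrow> 'v \<Rightarrow> 'v \<Rightarrow> 'f" where
  "ext_d X Y Z = act Y (G X Z) - act Z (G X Y) - G X (D Y Z - D Z Y)"

definition hodge :: "'v \<Rightarrow> 'v \<Rightarrow> 'f" where
  "hodge X Y = act Y (dvg X)
    + (\<Sum>i\<in>UNIV. act (E i) (ext_d X (E i) Y) - ext_d X (D (E i) (E i)) Y - ext_d X (E i) (D (E i) Y))"

lemma ext_d_eq:
  assumes [simp]: "X \<in> V" "Y \<in> V" "Z \<in> V"
  shows "ext_d X Y Z = G (D Y X) Z - G (D Z X) Y"
  by (simp add: ext_d_def)

text \<open>The term from the divergence differentiates \<open>X\<close> along \<open>Y\<close>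
  last, the one from the exterior derivative along \<open>E i\<close> last. Their difference is the
  curvature \<open>R (E i) Y X\<close>, whose trace is the Ricci term.\<close>

lemma weitzenboeck:
  assumes [simp]: "X \<in> V" "Y \<in> V"
  shows "hodge X Y = (\<Sum>i\<in>UNIV. G (D2 (E i) (E i) X) Y) - Ric Y X"
  unfolding hodge_def Ric_def act_dvg[OF assms]
  by (simp add: R_eq_D2 ext_d_eq algebra_simps flip: sum.distrib sum_subtractf)
     (auto intro!: sum.cong simp: D2_def algebra_simps)

text \<open>The Weitzenboeck formula exhibits \<open>hodge X\<close> as linear over
  \<open>F\<close>, being a product with a fixed field \<open>L\<close> minus a Ricci term. This
  identifies the inner product of \<open>df\<close> and \<open>\<Delta>\<gamma>\<close> in a frame
  with the value of \<open>\<Delta>\<gamma>\<close> on \<open>\<xi>\<close>.\<close>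

lemma hodge_expand:
  assumes [simp]: "X \<in> V" "Y \<in> V"
  shows "hodge X Y = (\<Sum>i\<in>UNIV. G Y (E i) * hodge X (E i))"
proof -
  define L where "L = (\<Sum>i\<in>UNIV. D2 (E i) (E i) X)"
  have L [simp]: "L \<in> V" by (simp add: L_def)
  have "G (\<Sum>i\<in>I. D2 (E i) (E i) X) Y = (\<Sum>i\<in>I. G (D2 (E i) (E i) X) Y)" if "Y \<in> V" for I Y
    using that by (induction I rule: infinite_finite_induct) auto
  then have hodge: "hodge X Y = G L Y - Ric Y X" if "Y \<in> V" for Y
    using that by (simp add: weitzenboeck L_def)
  have "(\<Sum>i\<in>UNIV. G Y (E i) * hodge X (E i))
      = (\<Sum>i\<in>UNIV. G L (E i) * G Y (E i)) - (\<Sum>i\<in>UNIV. G Y (E i) * Ric (E i) X)"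
    by (simp add: hodge algebra_simps sum_subtractf)
  also have "\<dots> = G L Y - Ric Y X"
    by (simp add: parseval bilinear_form_expand_left[OF frame bilinear_form_Ric assms(2,1), symmetric])
  finally show ?thesis by (simp add: hodge)
qed

end

section \<open>Gradient solitons and the derivative of the Laplacian of the potential\<close>

text \<open>The soliton equation is taken in its halved form, with the Hessian in place of the Lie
  derivative. The real constants become ring elements annihilated by every field, namely multiples
  of the indicator function.\<close>

locale gradient_soliton = levi_civita_frame F V e sc act D G E
  for F :: "'f::comm_ring set" and V :: "'v::ab_group_add set" and e sc act D G
    and E :: "'n::finite \<Rightarrow> 'v" +
  fixes \<xi> :: 'v and f lam \<mu> :: 'f
  assumes \<xi>_V [simp]: "\<xi> \<in> V" and f_F [simp]: "f \<in> F"
    and lam_F [simp]: "lam \<in> F" and \<mu>_F [simp]: "\<mu> \<in> F"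
    and act_lam [simp]: "X \<in> V \<Longrightarrow> act X lam = 0" and act_\<mu> [simp]: "X \<in> V \<Longrightarrow> act X \<mu> = 0"
    and act_f: "X \<in> V \<Longrightarrow> act X f = G \<xi> X"
    and soliton: "X \<in> V \<Longrightarrow> Y \<in> V \<Longrightarrow>
      G (D X \<xi>) Y + Ric X Y + lam * G X Y + \<mu> * (G \<xi> X * G \<xi> Y) = 0"
begin

lemma hess_sym: "X \<in> V \<Longrightarrow> Y \<in> V \<Longrightarrow> G (D X \<xi>) Y = G (D Y \<xi>) X"
  by (rule gradient_hess_sym[OF \<xi>_V f_F _ _ act_f])

lemma D2_hess_sym:
  assumes [simp]: "X \<in> V" "Y \<in> V" "Z \<in> V"
  shows "G (D2 Z X \<xi>) Y = G (D2 Z Y \<xi>) X"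
proof -
  have "act Z (G (D X \<xi>) Y) = act Z (G (D Y \<xi>) X)"
    by (simp only: hess_sym[of X Y] assms)
  then show ?thesis
    by (simp add: D2_def algebra_simps hess_sym[of X "D Z Y"] hess_sym[of Y "D Z X"])
qed

text \<open>The soliton equation expresses the Ricci tensor through the Hessian, the metric and the
  square of the form dual to \<open>\<xi>\<close>, all of which are symmetric.\<close>

lemma Ric_sym: "X \<in> V \<Longrightarrow> Y \<in> V \<Longrightarrow> Ric X Y = Ric Y X"
  using soliton[of X Y] soliton[of Y X] hess_sym[of X Y] G_commute[of X Y]
  by (simp add: mult.commute[of "G \<xi> X"]) (metis add_left_cancel add_right_cancel)

text \<open>Symmetry of the Hessian moves \<open>Y\<close> from the outer slot into a
  differentiation slot; commuting the two derivatives then yields the derivative of the divergence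
  and a curvature term.\<close>

lemma rough_laplacian_\<xi>:
  assumes [simp]: "Y \<in> V"
  shows "(\<Sum>i\<in>UNIV. G (D2 (E i) (E i) \<xi>) Y) = act Y (dvg \<xi>) + Ric Y \<xi>"
proof -
  have "G (D2 (E i) (E i) \<xi>) Y = G (D2 Y (E i) \<xi>) (E i) + G (R (E i) Y \<xi>) (E i)" for i
    by (simp add: R_eq_D2 D2_hess_sym[of "E i" Y])
  then show ?thesis by (simp add: act_dvg Ric_def sum.distrib)
qed

lemma act_trace_soliton:
  assumes [simp]: "Y \<in> V"
  defines "k \<equiv> \<mu> * G (D Y \<xi>) \<xi>"
  shows "act Y (dvg \<xi>) + act Y (\<Sum>j\<in>UNIV. Ric (E j) (E j)) + (k + k) = 0"
proof -
  \<comment> \<open>The constant sum over the index type is the dimension times \<open>lam\<close>,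
    again written without numerals; its derivative vanishes.\<close>
  have "dvg \<xi> + (\<Sum>j\<in>UNIV. Ric (E j) (E j)) + (\<Sum>j\<in>(UNIV::'n set). lam) + \<mu> * G \<xi> \<xi>
    = (\<Sum>j\<in>UNIV. G (D (E j) \<xi>) (E j) + Ric (E j) (E j) + lam * G (E j) (E j) + \<mu> * (G \<xi> (E j) * G \<xi> (E j)))"
    by (simp add: sum.distrib dvg_def G_E flip: parseval[of \<xi> \<xi>] sum_distrib_left)
  also have "\<dots> = 0" by (simp add: soliton)
  finally have "act Y (dvg \<xi> + (\<Sum>j\<in>UNIV. Ric (E j) (E j)) + (\<Sum>j\<in>(UNIV::'n set). lam) + \<mu> * G \<xi> \<xi>) = 0"
    by simp
  then show ?thesis
    by (simp add: k_def G_commute[of \<xi> "D Y \<xi>"] algebra_simps del: act_sum) (simp add: algebra_simps)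
qed

text \<open>The divergence of the Hessian gives the first two terms after commuting derivatives, the
  metric term is parallel, and the Leibniz rule for \<open>df \<otimes> df\<close> gives the two
  terms with \<open>\<mu>\<close>.\<close>

lemma divergence_soliton:
  assumes [simp]: "Y \<in> V"
  shows "(\<Sum>j\<in>UNIV. act (E j) (Ric Y (E j)) - Ric (D (E j) Y) (E j) - Ric Y (D (E j) (E j)))
    = - (act Y (dvg \<xi>) + Ric Y \<xi> + \<mu> * G (D Y \<xi>) \<xi> + \<mu> * (dvg \<xi> * G \<xi> Y))"
proof -
  have Ric: "Ric X Z = - (G (D X \<xi>) Z + lam * G X Z + \<mu> * (G \<xi> X * G \<xi> Z))" if "X \<in> V" "Z \<in> V" for X Z
    using soliton[OF that] by (simp add: algebra_simps eq_neg_iff_add_eq_0)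
  have "act (E j) (Ric Y (E j)) - Ric (D (E j) Y) (E j) - Ric Y (D (E j) (E j))
    = - (G (D2 Y (E j) \<xi>) (E j) + G (R (E j) Y \<xi>) (E j)
      + \<mu> * (G \<xi> (E j) * G (D Y \<xi>) (E j)) + \<mu> * (G (D (E j) \<xi>) (E j) * G \<xi> Y))" for j
    by (simp add: Ric R_eq_D2 hess_sym[of "E j" Y] algebra_simps) (simp add: D2_def algebra_simps)
  moreover have "(\<Sum>j\<in>UNIV. \<mu> * (G \<xi> (E j) * G (D Y \<xi>) (E j))) = \<mu> * G (D Y \<xi>) \<xi>"
    by (simp add: parseval G_commute[of \<xi> "D Y \<xi>"] flip: sum_distrib_left)
  moreover have "(\<Sum>j\<in>UNIV. \<mu> * (G (D (E j) \<xi>) (E j) * G \<xi> Y)) = \<mu> * (dvg \<xi> * G \<xi> Y)"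
    by (simp add: dvg_def sum_distrib_left sum_distrib_right)
  ultimately show ?thesis
    by (simp only: sum_negf sum.distrib act_dvg[OF \<xi>_V assms] Ric_def[of Y \<xi>])
qed

lemma act_dvg_\<xi>:
  assumes [simp]: "Y \<in> V"
  defines "k \<equiv> Ric Y \<xi> + \<mu> * (dvg \<xi> * G \<xi> Y)"
  shows "act Y (dvg \<xi>) = - (k + k)"
proof -
  define h where "h = \<mu> * G (D Y \<xi>) \<xi>"
  \<comment> \<open>The scalar curvature in the traced equation is replaced by twice the divergence,
    so the unwanted Hessian term \<open>h\<close> occurs twice with each sign.\<close>
  have "act Y (dvg \<xi>) + (- (act Y (dvg \<xi>) + k + h) + - (act Y (dvg \<xi>) + k + h)) + (h + h) = 0"
    using act_trace_soliton[OF assms(1)]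
    unfolding contracted_bianchi[OF assms(1)] divergence_soliton[OF assms(1)] h_def k_def
    by (simp only: ac_simps)
  also have "act Y (dvg \<xi>) + (- (act Y (dvg \<xi>) + k + h) + - (act Y (dvg \<xi>) + k + h)) + (h + h)
      = - (act Y (dvg \<xi>) + (k + k))"
    by (simp add: algebra_simps)
  finally show ?thesis by (simp add: eq_neg_iff_add_eq_0)
qed

text \<open>Two Ricci terms arise, one from the rough Laplacian of \<open>\<xi>\<close> and one from
  the Weitzenboeck formula for \<open>C\<close>; they cancel exactly against those in
  \<open>act_dvg_\<xi>\<close>.\<close>

theorem lap_G_\<xi>:
  assumes [simp]: "C \<in> V"
  defines "m \<equiv> \<Sum>i\<in>UNIV. \<Sum>j\<in>UNIV. G (D (E i) \<xi>) (E j) * G (D (E i) C) (E j)"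
    and "k \<equiv> \<mu> * (dvg \<xi> * G \<xi> C)"
  shows "lap (G \<xi> C) = hodge C \<xi> + m + m - k - k"
  unfolding lap_G[OF \<xi>_V assms(1)] rough_laplacian_\<xi>[OF assms(1)] act_dvg_\<xi>[OF assms(1)]
    weitzenboeck[OF assms(1) \<xi>_V]
  by (simp add: k_def m_def Ric_sym[of \<xi> C] algebra_simps)

end

section \<open>Locality and orthonormal frames\<close>

lemma vf_add_eq_plus: "vf_add X Y = X + Y"
  by (simp add: vf_add_def fun_eq_iff)

lemma sum_fun_apply [simp]: "(\<Sum>i\<in>I. F i) x = (\<Sum>i\<in>I. F i x)"
  by (induction I rule: infinite_finite_induct) auto

lemma vf_scale_apply [simp]: "vf_scale h X q f = h q * X q f"
  by (simp add: vf_scale_def)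

definition restrict_fun :: "'m set \<Rightarrow> ('m \<Rightarrow> real) \<Rightarrow> 'm \<Rightarrow> real" where
  "restrict_fun W h q = (if q \<in> W then h q else 0)"

definition restrict_field :: "'m set \<Rightarrow> 'm vfield \<Rightarrow> 'm vfield" where
  "restrict_field W X q f = (if q \<in> W then X q f else 0)"

lemma restrict_field_inside [simp]: "q \<in> W \<Longrightarrow> restrict_field W X q = X q"
  by (simp add: restrict_field_def fun_eq_iff)

lemma restrict_fun_inside [simp]: "q \<in> W \<Longrightarrow> restrict_fun W h q = h q"
  by (simp add: restrict_fun_def)

lemma restrict_fun_outside [simp]: "q \<notin> W \<Longrightarrow> restrict_fun W h q = 0"
  by (simp add: restrict_fun_def)

lemma restrict_field_outside [simp]: "q \<notin> W \<Longrightarrow> restrict_field W X q f = 0"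
  by (simp add: restrict_field_def)

lemma restrict_field_eq_scale: "restrict_field W X = vf_scale (restrict_fun W (\<lambda>_. 1)) X"
  by (auto simp: fun_eq_iff restrict_field_def restrict_fun_def vf_scale_def)

lemma restrict_field_cong: "(\<And>q. q \<in> W \<Longrightarrow> X q = Y q) \<Longrightarrow> restrict_field W X = restrict_field W Y"
  by (auto simp: fun_eq_iff restrict_field_def)

lemma restrict_fun_cong: "(\<And>q. q \<in> W \<Longrightarrow> f q = h q) \<Longrightarrow> restrict_fun W f = restrict_fun W h"
  by (auto simp: fun_eq_iff restrict_fun_def)

context differentiable_manifold begin

lemma smooth_restrict_fun: "smooth_fun_on A W h \<Longrightarrow> smooth_fun_on A W (restrict_fun W h)"
  by (erule smooth_fun_on_transfer) simp

lemma vector_field_restrict: "vector_field_on A W X \<Longrightarrow> vector_field_on A W (restrict_field W X)"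
  by (erule vector_field_on_transfer) simp

lemma vector_field_on_plus:
  "vector_field_on A W X \<Longrightarrow> vector_field_on A W Y \<Longrightarrow> vector_field_on A W (X + Y)"
  using vector_field_on_add by (simp add: vf_add_eq_plus)

lemma vector_field_on_zero:
  assumes "open W"
  shows "vector_field_on A W 0"
  unfolding vector_field_on_def
proof (intro conjI ballI allI impI)
  fix p
  obtain U \<phi> where c: "(U, \<phi>) \<in> A" "p \<in> U" by (rule chart_around)
  have "(\<lambda>f. 0 * dir_deriv A (U, \<phi>) p 0 f) \<in> tangent_space A p"
    by (rule tangent_space_scale) (simp add: tangent_space_chart[OF c])
  then show "0 p \<in> tangent_space A p" by (simp add: zero_fun_def)
next
  show "smooth_fun_on A (W \<inter> V') (\<lambda>q. 0 q f)" if "smooth_fun_on A V' f" for V' f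
    using smooth_fun_on_const[of "W \<inter> V'" 0] smooth_fun_on_open[OF that] assms by auto
qed fact

lemma vector_field_on_sum:
  assumes "open W" "\<And>i. i \<in> I \<Longrightarrow> vector_field_on A W (X i)"
  shows "vector_field_on A W (\<Sum>i\<in>I. X i)"
  using assms(2)
  by (induction I rule: infinite_finite_induct)
     (auto simp: vector_field_on_zero[OF \<open>open W\<close>] intro: vector_field_on_plus)

text \<open>Formulated for an arbitrary functional \<open>L\<close> at a fixed point, so that it
  serves both the metric and 1-forms. Additivity at \<open>0 + 0\<close> supplies the value at the
  zero field.\<close>

lemma linear_on_sum:
  assumes "q \<in> W" "open W"
    and add: "\<And>X Y. vector_field_on A W X \<Longrightarrow> vector_field_on A W Y \<Longrightarrow> L (X + Y) q = L X q + (L Y q :: real)"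
    and scale: "\<And>h X. smooth_fun_on A W h \<Longrightarrow> vector_field_on A W X \<Longrightarrow> L (vf_scale h X) q = h q * L X q"
    and h: "\<And>i. i \<in> I \<Longrightarrow> smooth_fun_on A W (h i)" and X: "\<And>i. i \<in> I \<Longrightarrow> vector_field_on A W (X i)"
  shows "L (\<Sum>i\<in>I. vf_scale (h i) (X i)) q = (\<Sum>i\<in>I. h i q * L (X i) q)"
proof -
  have "L 0 q = L (0 + 0) q" by simp
  then have "L 0 q = 0"
    using add[OF vector_field_on_zero vector_field_on_zero] assms(2) by simp
  then show ?thesis
    using h X
  proof (induction I rule: infinite_finite_induct)
    case (insert i I)
    let ?S = "\<Sum>i\<in>I. vf_scale (h i) (X i)"
    have "vector_field_on A W ?S"
      using insert.prems by (intro vector_field_on_sum[OF \<open>open W\<close>] vector_field_on_scale) auto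
    then have "L (vf_scale (h i) (X i) + ?S) q = L (vf_scale (h i) (X i)) q + L ?S q"
      using insert.prems by (intro add vector_field_on_scale) auto
    also have "L (vf_scale (h i) (X i)) q = h i q * L (X i) q"
      using insert.prems by (intro scale) auto
    also have "L ?S q = (\<Sum>i\<in>I. h i q * L (X i) q)"
      using insert.prems by (intro insert.IH) auto
    finally show ?case
      by (simp only: sum.insert[OF insert.hyps])
  qed simp_all
qed

end

section \<open>Locality of metric and connection, and existence of orthonormal frames\<close>

locale riemannian_manifold = differentiable_manifold A
  for A :: "('m::{t2_space,second_countable_topology}, 'n::finite) chart set" +
  fixes g :: "'m tensor2" and D :: "'m connection"
  assumes metric: "riemannian_metric A g" and levi_civita: "levi_civita A g D"
begin

lemma metric_smooth:
  assumes "vector_field_on A W X" "vector_field_on A W Y"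
  shows "smooth_fun_on A W (g X Y)"
  using metric assms smooth_fun_on_const[OF vector_field_on_open[OF assms(1)], of 0]
  unfolding riemannian_metric_def by blast

lemma metric_sym:
  assumes "vector_field_on A W X" "vector_field_on A W Y" "q \<in> W"
  shows "g X Y q = g Y X q"
  using metric assms smooth_fun_on_const[OF vector_field_on_open[OF assms(1)], of 0]
  unfolding riemannian_metric_def by blast

lemma metric_add:
  assumes "vector_field_on A W X" "vector_field_on A W Z" "vector_field_on A W Y" "q \<in> W"
  shows "g (X + Z) Y q = g X Y q + g Z Y q"
  using metric assms smooth_fun_on_const[OF vector_field_on_open[OF assms(1)], of 0]
  unfolding riemannian_metric_def vf_add_eq_plus by blast

lemma metric_scale:
  assumes "smooth_fun_on A W h" "vector_field_on A W X" "vector_field_on A W Y" "q \<in> W"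
  shows "g (vf_scale h X) Y q = h q * g X Y q"
  using metric assms unfolding riemannian_metric_def by blast

lemma metric_pos:
  assumes "vector_field_on A W X" "q \<in> W" "X q \<noteq> (\<lambda>_. 0)"
  shows "g X X q > 0"
  using metric assms smooth_fun_on_const[OF vector_field_on_open[OF assms(1)], of 0]
  unfolding riemannian_metric_def by blast

lemma metric_sum:
  assumes "\<And>i. i \<in> I \<Longrightarrow> smooth_fun_on A W (h i)" "\<And>i. i \<in> I \<Longrightarrow> vector_field_on A W (X i)"
    and Y: "vector_field_on A W Y" "q \<in> W"
  shows "g (\<Sum>i\<in>I. vf_scale (h i) (X i)) Y q = (\<Sum>i\<in>I. h i q * g (X i) Y q)"
  by (rule linear_on_sum[of q W "\<lambda>X. g X Y"])
     (use assms vector_field_on_open[OF Y(1)] in \<open>auto intro: metric_add metric_scale\<close>)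

lemma metric_local:
  assumes X: "vector_field_on A W X" and Y: "vector_field_on A W Y" and "q \<in> W"
  shows "g (restrict_field W X) Y q = g X Y q" "g X (restrict_field W Y) q = g X Y q"
proof -
  have r: "g (restrict_field W X) Y q = g X Y q"
    if X: "vector_field_on A W X" and Y: "vector_field_on A W Y" for X Y
    unfolding restrict_field_eq_scale
    using metric_scale[OF _ X Y \<open>q \<in> W\<close>, of "restrict_fun W (\<lambda>_. 1)"] \<open>q \<in> W\<close>
      smooth_restrict_fun[OF smooth_fun_on_const[OF vector_field_on_open[OF X]], of 1] by simp
  show "g (restrict_field W X) Y q = g X Y q" by (rule r[OF X Y])
  show "g X (restrict_field W Y) q = g X Y q"
    using r[OF Y X] metric_sym[OF X vector_field_restrict[OF Y] \<open>q \<in> W\<close>] metric_sym[OF X Y \<open>q \<in> W\<close>] by simp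
qed

text \<open>Fields that agree on \<open>W\<close> have literally equal restrictions, and restricting
  the arguments does not change the value on \<open>W\<close>.\<close>

lemma metric_eq:
  assumes "vector_field_on A W X" "vector_field_on A W Y" "q \<in> W"
    "\<And>r. r \<in> W \<Longrightarrow> X r = X' r" "\<And>r. r \<in> W \<Longrightarrow> Y r = Y' r"
  shows "g X Y q = g X' Y' q"
proof -
  have X': "vector_field_on A W X'" by (rule vector_field_on_transfer[OF assms(1,4)])
  have Y': "vector_field_on A W Y'" by (rule vector_field_on_transfer[OF assms(2,5)])
  have "restrict_field W X = restrict_field W X'" "restrict_field W Y = restrict_field W Y'"
    by (rule restrict_field_cong, simp add: assms)+
  then show ?thesis
    using metric_local(1)[OF assms(1,2,3)] metric_local(2)[OF vector_field_restrict[OF assms(1)] assms(2,3)]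
      metric_local(1)[OF X' Y' assms(3)] metric_local(2)[OF vector_field_restrict[OF X'] Y' assms(3)] by metis
qed

lemma connection_field:
  assumes "vector_field_on A W X" "vector_field_on A W Y"
  shows "vector_field_on A W (D X Y)"
  using levi_civita assms smooth_fun_on_const[OF vector_field_on_open[OF assms(1)], of 0]
  unfolding levi_civita_def affine_connection_def by blast

lemma connection_add_left:
  assumes "vector_field_on A W X" "vector_field_on A W Z" "vector_field_on A W Y" "q \<in> W"
  shows "D (X + Z) Y q = D X Y q + D Z Y q"
proof -
  have "D (vf_add X Z) Y q = (\<lambda>f. D X Y q f + D Z Y q f)"
    using levi_civita assms smooth_fun_on_const[OF vector_field_on_open[OF assms(1)], of 0]
    unfolding levi_civita_def affine_connection_def by blast
  then show ?thesis by (simp add: vf_add_eq_plus fun_eq_iff)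
qed

lemma connection_add_right:
  assumes "vector_field_on A W X" "vector_field_on A W Y" "vector_field_on A W Z" "q \<in> W"
  shows "D X (Y + Z) q = D X Y q + D X Z q"
proof -
  have "D X (vf_add Y Z) q = (\<lambda>f. D X Y q f + D X Z q f)"
    using levi_civita assms smooth_fun_on_const[OF vector_field_on_open[OF assms(1)], of 0]
    unfolding levi_civita_def affine_connection_def by blast
  then show ?thesis by (simp add: vf_add_eq_plus fun_eq_iff)
qed

lemma connection_scale_left:
  assumes "smooth_fun_on A W h" "vector_field_on A W X" "vector_field_on A W Y" "q \<in> W"
  shows "D (vf_scale h X) Y q = (\<lambda>f. h q * D X Y q f)"
  using levi_civita assms unfolding levi_civita_def affine_connection_def by blast

lemma connection_scale_right:
  assumes "smooth_fun_on A W h" "vector_field_on A W X" "vector_field_on A W Y" "q \<in> W"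
  shows "D X (vf_scale h Y) q = (\<lambda>f. X q h * Y q f + h q * D X Y q f)"
  using levi_civita assms unfolding levi_civita_def affine_connection_def by blast

lemma torsion_free:
  assumes "vector_field_on A W X" "vector_field_on A W Y" "q \<in> W"
  shows "lie_bracket A X Y q = D X Y q - D Y X q"
proof -
  have "(\<lambda>f. D X Y q f - D Y X q f) = lie_bracket A X Y q"
    using levi_civita assms unfolding levi_civita_def by blast
  then show ?thesis by (simp add: fun_eq_iff)
qed

lemma metric_compatible:
  assumes "vector_field_on A W X" "vector_field_on A W Y" "vector_field_on A W Z" "q \<in> W"
  shows "X q (g Y Z) = g (D X Y) Z q + g Y (D X Z) q"
  using levi_civita assms unfolding levi_civita_def by blast

text \<open>In the differentiated slot the Leibniz rule adds a derivative of the indicator function,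
  which vanishes because that function is constantly 1 near each point of \<open>W\<close>.\<close>

lemma connection_local:
  assumes X: "vector_field_on A W X" and Y: "vector_field_on A W Y" and q: "q \<in> W"
  shows "D (restrict_field W X) Y q = D X Y q" "D X (restrict_field W Y) q = D X Y q"
proof -
  let ?e = "restrict_fun W (\<lambda>_. 1)"
  have W: "open W" using X by (rule vector_field_on_open)
  have e: "smooth_fun_on A W ?e"
    by (intro smooth_restrict_fun smooth_fun_on_const W)
  have "X q ?e = X q (\<lambda>_. 1)"
    using vector_field_on_tangent[OF X q] W q by (rule tangent_vector_local) simp
  then have "X q ?e = 0"
    using tangent_vector_const[OF vector_field_on_tangent[OF X q]] by simp
  then show "D (restrict_field W X) Y q = D X Y q" "D X (restrict_field W Y) q = D X Y q"
    unfolding restrict_field_eq_scale connection_scale_left[OF e X Y q] connection_scale_right[OF e X Y q]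
    using q by simp_all
qed

lemma connection_eq:
  assumes "vector_field_on A W X" "vector_field_on A W Y" "q \<in> W"
    "\<And>r. r \<in> W \<Longrightarrow> X r = X' r" "\<And>r. r \<in> W \<Longrightarrow> Y r = Y' r"
  shows "D X Y q = D X' Y' q"
proof -
  have X': "vector_field_on A W X'" by (rule vector_field_on_transfer[OF assms(1,4)])
  have Y': "vector_field_on A W Y'" by (rule vector_field_on_transfer[OF assms(2,5)])
  have "restrict_field W X = restrict_field W X'" "restrict_field W Y = restrict_field W Y'"
    by (rule restrict_field_cong, simp add: assms)+
  then show ?thesis
    using connection_local(1)[OF assms(1,2,3)] connection_local(2)[OF vector_field_restrict[OF assms(1)] assms(2,3)]
      connection_local(1)[OF X' Y' assms(3)] connection_local(2)[OF vector_field_restrict[OF X'] Y' assms(3)] by metis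
qed

text \<open>The last conjunct makes the next coordinate field linearly independent of the fields
  obtained so far.\<close>

lemma gram_schmidt:
  assumes c: "(U, \<phi>) \<in> A" and "finite I"
  shows "\<exists>E. (\<forall>i\<in>I. vector_field_on A U (E i)) \<and>
    (\<forall>i\<in>I. \<forall>j\<in>I. \<forall>q\<in>U. g (E i) (E j) q = (if i = j then 1 else 0)) \<and>
    (\<forall>i\<in>I. \<forall>k. k \<notin> I \<longrightarrow> (\<forall>q\<in>U. E i q (\<lambda>r. \<phi> r $ k) = 0))"
  using assms(2)
proof (induction I rule: finite_induct)
  case empty
  then show ?case by simp
next
  case (insert k I)
  from insert.IH obtain E where "(\<forall>i\<in>I. vector_field_on A U (E i)) \<and>
    (\<forall>i\<in>I. \<forall>j\<in>I. \<forall>q\<in>U. g (E i) (E j) q = (if i = j then 1 else 0)) \<and>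
    (\<forall>i\<in>I. \<forall>k. k \<notin> I \<longrightarrow> (\<forall>q\<in>U. E i q (\<lambda>r. \<phi> r $ k) = 0))" ..
  then have E: "\<And>i. i \<in> I \<Longrightarrow> vector_field_on A U (E i)"
    and orth: "\<And>i j q. i \<in> I \<Longrightarrow> j \<in> I \<Longrightarrow> q \<in> U \<Longrightarrow> g (E i) (E j) q = (if i = j then 1 else 0)"
    and coord: "\<And>i l q. i \<in> I \<Longrightarrow> l \<notin> I \<Longrightarrow> q \<in> U \<Longrightarrow> E i q (\<lambda>r. \<phi> r $ l) = 0"
    by simp_all
  have U: "open U" using c by (rule open_chart)
  define P where "P = (\<lambda>q. dir_deriv A (U, \<phi>) q (axis k 1))"
  have P: "vector_field_on A U P" unfolding P_def using c by (rule vector_field_on_coordinate)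
  define h where "h i = (\<lambda>q. - g P (E i) q)" for i
  have h: "smooth_fun_on A U (h i)" if "i \<in> I" for i
    unfolding h_def by (intro smooth_fun_on_uminus metric_smooth P E that)
  define T where "T = (\<Sum>i\<in>I. vf_scale (h i) (E i))"
  have T: "vector_field_on A U T"
    unfolding T_def by (intro vector_field_on_sum vector_field_on_scale h E U)
  have V: "vector_field_on A U (P + T)" by (intro vector_field_on_plus P T)
  have VE: "g (P + T) (E j) q = 0" if "j \<in> I" "q \<in> U" for j q
  proof -
    have "g T (E j) q = (\<Sum>i\<in>I. h i q * g (E i) (E j) q)"
      unfolding T_def by (rule metric_sum) (use h E that in auto)
    also have "\<dots> = (\<Sum>i\<in>I. if i = j then h i q else 0)"
      by (intro sum.cong) (auto simp: orth that)
    also have "\<dots> = h j q" using that insert.hyps by simp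
    finally show ?thesis using metric_add[OF P T E[OF that(1)] that(2)] by (simp add: h_def)
  qed
  have Vc: "(P + T) q (\<lambda>r. \<phi> r $ l) = (if l = k then 1 else 0)" if "l \<notin> I" "q \<in> U" for l q
    using that by (simp add: T_def P_def dir_deriv_coordinate[OF c that(2)] coord axis_def)
  have pos: "g (P + T) (P + T) q > 0" if "q \<in> U" for q
  proof (rule metric_pos[OF V that])
    \<comment> \<open>The coordinate with index \<open>k\<close> is 1: the correction
      \<open>T\<close> combines fields whose coordinates outside \<open>I\<close> vanish.\<close>
    show "(P + T) q \<noteq> (\<lambda>_. 0)"
      using Vc[OF insert(2) that] by (auto simp del: plus_fun_apply)
  qed
  define r where "r = (\<lambda>q. inverse (sqrt (g (P + T) (P + T) q)))"
  have r: "smooth_fun_on A U r"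
    unfolding r_def by (intro smooth_fun_on_inverse_sqrt metric_smooth V pos)
  define N where "N = vf_scale r (P + T)"
  have N: "vector_field_on A U N" unfolding N_def by (intro vector_field_on_scale V r)
  have NE: "g N (E j) q = 0" "g (E j) N q = 0" if "j \<in> I" "q \<in> U" for j q
    using metric_scale[OF r V E[OF that(1)] that(2)] VE[OF that] metric_sym[OF E[OF that(1)] N that(2)]
    by (simp_all add: N_def)
  have NN: "g N N q = 1" if "q \<in> U" for q
  proof -
    have "g N N q = r q * (r q * g (P + T) (P + T) q)"
      using metric_scale[OF r V N that] metric_scale[OF r V V that] metric_sym[OF V N that] by (simp add: N_def)
    also have "\<dots> = 1"
      using pos[OF that] by (simp add: r_def field_simps)
    finally show ?thesis .
  qed
  let ?E = "E(k := N)"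
  have "\<forall>i\<in>insert k I. vector_field_on A U (?E i)"
    using E N by auto
  moreover have "\<forall>i\<in>insert k I. \<forall>j\<in>insert k I. \<forall>q\<in>U. g (?E i) (?E j) q = (if i = j then 1 else 0)"
    using insert.hyps orth NE NN by auto
  moreover have "\<forall>i\<in>insert k I. \<forall>l. l \<notin> insert k I \<longrightarrow> (\<forall>q\<in>U. ?E i q (\<lambda>r. \<phi> r $ l) = 0)"
    using coord Vc by (auto simp: N_def simp del: plus_fun_apply)
  ultimately show ?case by (intro exI[of _ ?E] conjI)
qed

lemma frame_nearE:
  obtains W where "p \<in> W" "orthonormal_frame_on A g W (frame_near A g p)"
proof -
  obtain U \<phi> where c: "(U, \<phi>) \<in> A" "p \<in> U" by (rule chart_around)
  from gram_schmidt[OF c(1), of UNIV]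
  obtain E where "orthonormal_frame_on A g U E"
    by (auto simp: orthonormal_frame_on_def)
  with c(2) have "\<exists>E W. p \<in> W \<and> orthonormal_frame_on A g W E" by blast
  then have "\<exists>W. p \<in> W \<and> orthonormal_frame_on A g W (frame_near A g p)"
    unfolding frame_near_def by (rule someI_ex)
  then show ?thesis using that by auto
qed

text \<open>A dimension count at \<open>q\<close>: the linear map \<open>L\<close> sends coordinate
  components to the products with the frame. It hits every basis vector, so it is surjective and
  hence injective on \<open>real^'n\<close>, and \<open>X\<close> has the same image as its
  expansion.\<close>

lemma frame_expand:
  assumes E: "orthonormal_frame_on A g W E" and X: "vector_field_on A W X" and q: "q \<in> W"
  shows "X q f = (\<Sum>i\<in>UNIV. g X (E i) q * E i q f)"
proof -
  obtain U \<phi> where c: "(U, \<phi>) \<in> A" "q \<in> U" by (rule chart_around)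
  define W' where "W' = W \<inter> U"
  have W': "open W'" "W' \<subseteq> W" "W' \<subseteq> U" "q \<in> W'"
    using vector_field_on_open[OF X] open_chart[OF c(1)] c q by (auto simp: W'_def)
  define P where "P i = (\<lambda>q. dir_deriv A (U, \<phi>) q (axis i 1))" for i
  have P: "vector_field_on A W' (P i)" for i
    unfolding P_def by (rule vector_field_on_subset[OF vector_field_on_coordinate[OF c(1)] W'(1,3)])
  have E': "vector_field_on A W' (E i)" for i
    using E W' vector_field_on_subset[of W] by (auto simp: orthonormal_frame_on_def)
  define L where "L a = (\<chi> i. \<Sum>j\<in>UNIV. a $ j * g (P j) (E i) q)" for a :: "real^'n"
  have L: "linear L"
    by (rule linearI) (simp_all add: L_def vec_eq_iff sum.distrib algebra_simps sum_distrib_left)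
  define co where "co Z = (\<chi> i. Z q (\<lambda>r. \<phi> r $ i))" for Z :: "'m vfield"
  have Lco: "L (co Z) $ i = g Z (E i) q" if Z: "vector_field_on A W' Z" for Z i
  proof -
    have s: "smooth_fun_on A W' (\<lambda>r. Z r (\<lambda>s. \<phi> s $ j))" for j
      by (rule vector_field_on_smooth[OF Z smooth_fun_on_subset[OF smooth_coordinate[OF c(1)] W'(1,3)]])
    \<comment> \<open>The metric takes fields as arguments, so the expansion in coordinate fields
      must hold on a neighbourhood, not only at \<open>q\<close>.\<close>
    have "Z r = (\<Sum>j\<in>UNIV. vf_scale (\<lambda>r. Z r (\<lambda>s. \<phi> s $ j)) (P j)) r" if "r \<in> W'" for r
      using tangent_vector_expand[OF c(1) _ vector_field_on_tangent[OF Z that]] that W'(3)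
      by (auto simp: P_def fun_eq_iff)
    then have "g Z (E i) q = g (\<Sum>j\<in>UNIV. vf_scale (\<lambda>r. Z r (\<lambda>s. \<phi> s $ j)) (P j)) (E i) q"
      by (intro metric_eq[OF Z E' W'(4)]) auto
    also have "\<dots> = (\<Sum>j\<in>UNIV. Z q (\<lambda>s. \<phi> s $ j) * g (P j) (E i) q)"
      by (rule metric_sum[OF s P E' W'(4)])
    finally show ?thesis by (simp add: L_def co_def)
  qed
  have co_E: "L (co (E i)) = axis i 1" for i
    using E q by (auto simp: vec_eq_iff Lco[OF E'] orthonormal_frame_on_def axis_def)
  have "b \<in> range L" for b
  proof -
    have "L (\<Sum>i\<in>UNIV. b $ i *\<^sub>R co (E i)) = (\<Sum>i\<in>UNIV. b $ i *\<^sub>R axis i 1)"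
      by (simp add: linear_sum[OF L] linear_scale[OF L] co_E)
    also have "\<dots> = b"
      using basis_expansion[of b] by (simp add: scalar_mult_eq_scaleR)
    finally show ?thesis by (metis rangeI)
  qed
  then have inj: "inj L"
    using linear_surjective_imp_injective[OF L] by auto
  have X': "vector_field_on A W' X" by (rule vector_field_on_subset[OF X W'(1,2)])
  have "L (co X) = L (\<Sum>i\<in>UNIV. g X (E i) q *\<^sub>R co (E i))"
    by (simp add: linear_sum[OF L] linear_scale[OF L] co_E vec_eq_iff Lco[OF X'] axis_def
        if_distrib[of "(*) _"] cong: if_cong)
  then have co: "co X = (\<Sum>i\<in>UNIV. g X (E i) q *\<^sub>R co (E i))"
    using inj by (simp add: inj_def)
  have dd: "dir_deriv A (U, \<phi>) q (co Z) = Z q" if "vector_field_on A W' Z" for Z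
    unfolding co_def
    by (rule tangent_space_coordinates[OF c vector_field_on_tangent[OF that W'(4)], symmetric])
  have "X q f = dir_deriv A (U, \<phi>) q (co X) f" by (simp add: dd[OF X'])
  also have "\<dots> = (\<Sum>i\<in>UNIV. g X (E i) q * dir_deriv A (U, \<phi>) q (co (E i)) f)"
    unfolding co by (simp add: linear_sum[OF dir_deriv_linear[OF c]] linear_scale[OF dir_deriv_linear[OF c]])
  finally show ?thesis by (simp add: dd[OF E'])
qed

end

section \<open>Vector fields on a chart domain as an algebraic model\<close>

context differentiable_manifold begin

lemma vector_field_on_minus:
  assumes X: "vector_field_on A W X" and Y: "vector_field_on A W Y"
  shows "vector_field_on A W (X - Y)"
proof -
  have "vector_field_on A W (X + vf_scale (\<lambda>_. - 1) Y)"
    by (intro vector_field_on_plus X vector_field_on_scale Y smooth_fun_on_const vector_field_on_open[OF X])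
  moreover have "X + vf_scale (\<lambda>_. - 1) Y = X - Y"
    by (simp add: fun_eq_iff)
  ultimately show ?thesis by simp
qed

lemma one_form_smooth:
  assumes "one_form A \<gamma>" "vector_field_on A W X"
  shows "smooth_fun_on A W (\<gamma> X)"
  using assms smooth_fun_on_const[OF vector_field_on_open[OF assms(2)], of 0]
  unfolding one_form_def by blast

lemma one_form_add:
  assumes "one_form A \<gamma>" "vector_field_on A W X" "vector_field_on A W Y" "q \<in> W"
  shows "\<gamma> (X + Y) q = \<gamma> X q + \<gamma> Y q"
  using assms smooth_fun_on_const[OF vector_field_on_open[OF assms(2)], of 0]
  unfolding one_form_def vf_add_eq_plus by blast

lemma one_form_scale:
  assumes "one_form A \<gamma>" "smooth_fun_on A W h" "vector_field_on A W X" "q \<in> W"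
  shows "\<gamma> (vf_scale h X) q = h q * \<gamma> X q"
  using assms unfolding one_form_def by blast

lemma one_form_eq:
  assumes \<gamma>: "one_form A \<gamma>" and X: "vector_field_on A W X" and q: "q \<in> W"
    and XY: "\<And>r. r \<in> W \<Longrightarrow> X r = Y r"
  shows "\<gamma> X q = \<gamma> Y q"
proof -
  have r: "\<gamma> (restrict_field W X) q = \<gamma> X q" if X: "vector_field_on A W X" for X
    unfolding restrict_field_eq_scale
    using one_form_scale[OF \<gamma> smooth_restrict_fun[OF smooth_fun_on_const[OF vector_field_on_open[OF X]]] X q, of 1] q
    by simp
  have "restrict_field W X = restrict_field W Y"
    by (rule restrict_field_cong) (rule XY)
  then show ?thesis
    using r[OF X] r[OF vector_field_on_transfer[OF X XY]] by simp
qed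

definition funs_on :: "'m set \<Rightarrow> ('m \<Rightarrow> real) set" where
  "funs_on W = {h. smooth_fun_on A W h \<and> (\<forall>q. q \<notin> W \<longrightarrow> h q = 0)}"

definition fields_on :: "'m set \<Rightarrow> 'm vfield set" where
  "fields_on W = {X. vector_field_on A W X \<and> (\<forall>q f. q \<notin> W \<longrightarrow> X q f = 0)}"

lemma funs_onI: "smooth_fun_on A W h \<Longrightarrow> (\<And>q. q \<notin> W \<Longrightarrow> h q = 0) \<Longrightarrow> h \<in> funs_on W"
  by (simp add: funs_on_def)

lemma fields_onI: "vector_field_on A W X \<Longrightarrow> (\<And>q f. q \<notin> W \<Longrightarrow> X q f = 0) \<Longrightarrow> X \<in> fields_on W"
  by (simp add: fields_on_def)

lemma funs_onD: "h \<in> funs_on W \<Longrightarrow> smooth_fun_on A W h" "h \<in> funs_on W \<Longrightarrow> q \<notin> W \<Longrightarrow> h q = 0"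
  by (simp_all add: funs_on_def)

lemma fields_onD: "X \<in> fields_on W \<Longrightarrow> vector_field_on A W X" "X \<in> fields_on W \<Longrightarrow> q \<notin> W \<Longrightarrow> X q f = 0"
  by (simp_all add: fields_on_def)

lemma restrict_fun_in [simp]: "smooth_fun_on A W h \<Longrightarrow> restrict_fun W h \<in> funs_on W"
  by (auto intro: funs_onI smooth_restrict_fun)

lemma restrict_field_in [simp]: "vector_field_on A W X \<Longrightarrow> restrict_field W X \<in> fields_on W"
  by (auto intro: fields_onI vector_field_restrict)

lemma restrict_fields_on [simp]: "X \<in> fields_on W \<Longrightarrow> restrict_field W X = X"
  by (auto simp: fun_eq_iff restrict_field_def fields_onD)

lemma vector_field_restrict_fun:
  assumes "vector_field_on A W X" "q \<in> W"
  shows "X q (restrict_fun W h) = X q h"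
  using vector_field_on_tangent[OF assms] vector_field_on_open[OF assms(1)] assms(2)
  by (rule tangent_vector_local) simp

end

text \<open>Inside a single chart the coordinate functions are smooth on all of \<open>W\<close> and
  thus available as the test functions for \<open>act_faithful\<close>.\<close>

locale chart_region = riemannian_manifold A g D
  for A :: "('m::{t2_space,second_countable_topology}, 'n::finite) chart set" and g D +
  fixes W :: "'m set"
  assumes open_W: "open W" and in_chart: "\<exists>(U, \<phi>)\<in>A. W \<subseteq> U"
begin

abbreviation "rfun \<equiv> restrict_fun W"
abbreviation "rfield \<equiv> restrict_field W"

lemma fun_eqI: "(\<And>q. q \<in> W \<Longrightarrow> f q = h q) \<Longrightarrow> (\<And>q. q \<notin> W \<Longrightarrow> f q = h q) \<Longrightarrow> f = h"
  by (auto simp: fun_eq_iff)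

sublocale alg: levi_civita_algebra "funs_on W" "fields_on W" "rfun (\<lambda>_. 1)" vf_scale
  "\<lambda>X h. rfun (\<lambda>q. X q h)" "\<lambda>X Y. rfield (D X Y)" "\<lambda>X Y. rfun (g X Y)"
proof (unfold_locales, goal_cases)
  case 1
  show ?case using smooth_fun_on_const[OF open_W, of 0] by (auto intro: funs_onI simp: zero_fun_def)
next
  case 2
  show ?case by (simp add: smooth_fun_on_const[OF open_W])
next
  case (3 a b)
  then show ?case
    using smooth_fun_on_add[of W a b] by (auto intro!: funs_onI simp: funs_onD plus_fun_def)
next
  case (4 a)
  then show ?case
    using smooth_fun_on_uminus[of W a] by (auto intro!: funs_onI simp: funs_onD fun_Compl_def)
next
  case (5 a b)
  then show ?case
    using smooth_fun_on_mult[of W a b] by (auto intro!: funs_onI simp: funs_onD times_fun_def)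
next
  case (6 a)
  then show ?case by (intro fun_eqI) (auto simp: funs_onD)
next
  case 7
  show ?case by (intro fields_onI vector_field_on_zero[OF open_W]) simp
next
  case (8 X Y)
  then show ?case by (intro fields_onI vector_field_on_plus) (auto simp: fields_onD)
next
  case (9 X)
  then show ?case
    using vector_field_on_minus[OF vector_field_on_zero[OF open_W], of X]
    by (intro fields_onI) (auto simp: fields_onD)
next
  case (10 a X)
  then show ?case by (intro fields_onI vector_field_on_scale) (auto simp: fields_onD funs_onD)
next
  case (11 a X Y)
  show ?case by (simp add: fun_eq_iff algebra_simps)
next
  case (12 a b X)
  show ?case by (simp add: fun_eq_iff algebra_simps)
next
  case (13 a b X)
  show ?case by (simp add: fun_eq_iff algebra_simps)
next
  case (14 X a)
  then show ?case by (simp add: vector_field_on_smooth fields_onD funs_onD)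
next
  case (15 X a b)
  show ?case
  proof (intro fun_eqI)
    fix q assume "q \<in> W"
    then show "rfun (\<lambda>q. X q (a + b)) q = (rfun (\<lambda>q. X q a) + rfun (\<lambda>q. X q b)) q"
      using tangent_vector_add[OF vector_field_on_tangent[OF fields_onD(1)[OF 15(1)]]
          smooth_nearI[OF funs_onD(1)[OF 15(2)]] smooth_nearI[OF funs_onD(1)[OF 15(3)]]]
      by (simp add: plus_fun_def)
  qed simp
next
  case (16 X a b)
  show ?case
  proof (intro fun_eqI)
    fix q assume "q \<in> W"
    then show "rfun (\<lambda>q. X q (a * b)) q = (rfun (\<lambda>q. X q a) * b + a * rfun (\<lambda>q. X q b)) q"
      using tangent_vector_mult[OF vector_field_on_tangent[OF fields_onD(1)[OF 16(1)]]
          smooth_nearI[OF funs_onD(1)[OF 16(2)]] smooth_nearI[OF funs_onD(1)[OF 16(3)]]]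
      by (simp add: times_fun_def)
  qed simp
next
  case (17 X Y a)
  show ?case by (intro fun_eqI) auto
next
  \<comment> \<open>This goal is \<open>act_faithful\<close>: a field that kills the coordinate
    functions has vanishing components.\<close>
  case (18 X)
  obtain U \<phi> where c: "(U, \<phi>) \<in> A" "W \<subseteq> U" using in_chart by auto
  have X: "vector_field_on A W X" using 18 by (simp add: fields_onD)
  have "X q f = 0" if "q \<in> W" for q f
  proof -
    have q: "q \<in> U" using c that by auto
    have "X q (\<lambda>r. \<phi> r $ i) = 0" for i
    proof -
      have "rfun (\<lambda>q. X q (rfun (\<lambda>r. \<phi> r $ i))) = 0"
        by (intro 18 restrict_fun_in smooth_fun_on_subset[OF smooth_coordinate[OF c(1)] open_W c(2)])
      from fun_cong[OF this, of q] show ?thesis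
        using that by (simp add: vector_field_restrict_fun[OF X that])
    qed
    then show ?thesis
      using tangent_vector_expand[OF c(1) q vector_field_on_tangent[OF X that], of f] by simp
  qed
  moreover have "X q f = 0" if "q \<notin> W" for q f
    using 18 that by (simp add: fields_onD)
  ultimately show ?case by (auto simp: fun_eq_iff)
next
  case (19 X Y)
  then show ?case by (simp add: fields_onD connection_field)
next
  case (20 X Y Z)
  then show ?case
    by (intro fun_eqI) (simp_all add: connection_add_left[of W] fields_onD fun_eq_iff)
next
  case (21 a X Y)
  then show ?case
    by (intro fun_eqI) (simp_all add: connection_scale_left[of W] fields_onD funs_onD fun_eq_iff)
next
  case (22 X Y Z)
  then show ?case
    by (intro fun_eqI) (simp_all add: connection_add_right[of W] fields_onD fun_eq_iff)
next
  case (23 a X Y)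
  then show ?case
    by (intro fun_eqI) (simp_all add: connection_scale_right[of W] fields_onD funs_onD fun_eq_iff)
next
  case (24 X Y a)
  then have X: "vector_field_on A W X" and Y: "vector_field_on A W Y" and a: "smooth_fun_on A W a"
    by (simp_all add: fields_onD funs_onD)
  show ?case
  proof (intro fun_eqI)
    fix q assume q: "q \<in> W"
    \<comment> \<open>\<open>lie_bracket\<close> is the commutator only on functions smooth near the
      point, which holds for \<open>a\<close> as an element of the ring.\<close>
    have "lie_bracket A X Y q a = D X Y q a - D Y X q a"
      using torsion_free[OF X Y q] by simp
    then show "(rfun (\<lambda>q. rfield (D X Y) q a) - rfun (\<lambda>q. rfield (D Y X) q a)) q
      = (rfun (\<lambda>q. X q (rfun (\<lambda>q. Y q a))) - rfun (\<lambda>q. Y q (rfun (\<lambda>q. X q a)))) q"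
      using q smooth_nearI[OF a q]
      by (simp add: vector_field_restrict_fun[OF X q] vector_field_restrict_fun[OF Y q] lie_bracket_def)
  qed simp
next
  case (25 X Y)
  then show ?case by (simp add: fields_onD metric_smooth)
next
  case (26 X Y)
  then show ?case by (intro restrict_fun_cong metric_sym[of W]) (simp_all add: fields_onD)
next
  case (27 X Y Z)
  then show ?case by (intro fun_eqI) (simp_all add: metric_add[of W] fields_onD)
next
  case (28 a X Y)
  then show ?case by (intro fun_eqI) (simp_all add: metric_scale[of W] fields_onD funs_onD)
next
  case (29 X Y Z)
  then have v: "vector_field_on A W X" "vector_field_on A W Y" "vector_field_on A W Z"
    by (simp_all add: fields_onD)
  show ?case
  proof (intro fun_eqI)
    fix q assume q: "q \<in> W"
    then show "rfun (\<lambda>q. X q (rfun (g Y Z))) q = (rfun (g (rfield (D X Y)) Z) + rfun (g Y (rfield (D X Z)))) q"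
      using v by (simp add: vector_field_restrict_fun metric_compatible[OF v q] metric_local connection_field)
  qed simp
qed

end

context chart_region begin

lemma rfield_D:
  assumes "vector_field_on A W X" "vector_field_on A W Y"
  shows "rfield (D (rfield X) (rfield Y)) = rfield (D X Y)"
  by (rule restrict_field_cong, rule connection_eq[of W]) (simp_all add: vector_field_restrict assms)

lemma rfun_g:
  assumes "vector_field_on A W X" "vector_field_on A W Y"
  shows "rfun (g (rfield X) (rfield Y)) = rfun (g X Y)"
  by (rule restrict_fun_cong, rule metric_eq[of W]) (simp_all add: vector_field_restrict assms)

lemma rfield_D_left:
  assumes "vector_field_on A W X" "vector_field_on A W Y"
  shows "rfield (D (rfield X) Y) = rfield (D X Y)"
  by (rule restrict_field_cong, rule connection_eq[of W]) (simp_all add: vector_field_restrict assms)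

lemma rfield_D_right:
  assumes "vector_field_on A W X" "vector_field_on A W Y"
  shows "rfield (D X (rfield Y)) = rfield (D X Y)"
  by (rule restrict_field_cong, rule connection_eq[of W]) (simp_all add: vector_field_restrict assms)

lemma rfield_lie_bracket:
  assumes "vector_field_on A W X" "vector_field_on A W Y"
  shows "rfield (D X Y) - rfield (D Y X) = rfield (lie_bracket A X Y)"
  by (rule fun_eqI) (simp_all add: torsion_free[OF assms] fun_eq_iff)

lemma lie_bracket_field:
  assumes "vector_field_on A W X" "vector_field_on A W Y"
  shows "vector_field_on A W (lie_bracket A X Y)"
  by (rule vector_field_on_transfer[OF vector_field_on_minus[OF connection_field[OF assms] connection_field[OF assms(2,1)]]])
     (simp add: torsion_free[OF assms])

lemma curvature_field:
  assumes [simp]: "vector_field_on A W X" "vector_field_on A W Y" "vector_field_on A W Z"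
  shows "vector_field_on A W (curvature A D X Y Z)"
proof -
  have "curvature A D X Y Z = D X (D Y Z) - D Y (D X Z) - D (lie_bracket A X Y) Z"
    by (simp add: curvature_def fun_eq_iff)
  then show ?thesis by (simp add: vector_field_on_minus connection_field lie_bracket_field)
qed

lemma alg_R:
  assumes [simp]: "vector_field_on A W X" "vector_field_on A W Y" "vector_field_on A W Z"
  shows "alg.R (rfield X) (rfield Y) (rfield Z) = rfield (curvature A D X Y Z)"
proof -
  have "rfield (curvature A D X Y Z) = rfield (D X (D Y Z)) - rfield (D Y (D X Z)) - rfield (D (lie_bracket A X Y) Z)"
    by (simp add: curvature_def fun_eq_iff restrict_field_def)
  then show ?thesis
    by (simp add: alg.R_def rfield_D rfield_lie_bracket connection_field lie_bracket_field)
qed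

lemma alg_frame:
  assumes E: "orthonormal_frame_on A g W' E" and W': "W \<subseteq> W'"
  shows "alg.orthonormal_frame (\<lambda>i. rfield (E i))"
  unfolding alg.orthonormal_frame_def
proof (intro conjI allI ballI)
  have E': "vector_field_on A W (E i)" for i
    using E W' open_W by (auto simp: orthonormal_frame_on_def intro: vector_field_on_subset)
  show "rfield (E i) \<in> fields_on W" for i by (simp add: E')
  show "rfun (g (rfield (E i)) (rfield (E j))) = (if i = j then rfun (\<lambda>_. 1) else 0)" for i j
    using E W' by (intro fun_eqI) (auto simp: rfun_g E' orthonormal_frame_on_def)
  fix X assume X: "X \<in> fields_on W"
  have EW: "orthonormal_frame_on A g W E"
    using E E' W' by (auto simp: orthonormal_frame_on_def)
  have "X q f = (\<Sum>i\<in>UNIV. vf_scale (rfun (g X (rfield (E i)))) (rfield (E i))) q f" for q f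
    using frame_expand[OF EW fields_onD(1)[OF X], of q f] metric_local(2)[OF fields_onD(1)[OF X] E', of q]
    by (cases "q \<in> W") (simp_all add: fields_onD[OF X])
  then show "X = (\<Sum>i\<in>UNIV. vf_scale (rfun (g X (rfield (E i)))) (rfield (E i)))"
    by (simp only: fun_eq_iff) blast
qed

lemma chart_region_Int: "open W' \<Longrightarrow> chart_region A g D (W \<inter> W')"
  using in_chart open_W by unfold_locales auto

text \<open>The frame \<open>frame_near\<close> depends on the point, so traces have to be expressed in one frame on an
  open set before they can be differentiated.\<close>

lemma ricci_frame:
  assumes E: "orthonormal_frame_on A g W E" and Y: "vector_field_on A W Y" and Z: "vector_field_on A W Z"
    and q: "q \<in> W"
  shows "ricci A g D Y Z q = (\<Sum>i\<in>UNIV. g (curvature A D (E i) Y Z) (E i) q)"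
proof -
  obtain W' where W': "q \<in> W'" "orthonormal_frame_on A g W' (frame_near A g q)" by (rule frame_nearE)
  have o: "open W'" using W'(2) vector_field_on_open by (auto simp: orthonormal_frame_on_def)
  let ?W = "W \<inter> W'"
  \<comment> \<open>Both frames live on the intersection, where their traces of the same bilinear
    form \<open>b\<close> can be compared.\<close>
  interpret r: chart_region A g D ?W using o by (rule chart_region_Int)
  have sub: "vector_field_on A ?W X" if "vector_field_on A W X" for X
    using that r.open_W by (rule vector_field_on_subset) simp
  note Y' = sub[OF Y] and Z' = sub[OF Z]
  define b where "b X U = r.rfun (g (r.alg.R X (r.rfield Y) (r.rfield Z)) U)" for X U
  have b: "r.alg.bilinear_form b"
    unfolding b_def by (rule r.alg.bilinear_form_G_R) (simp_all add: Y' Z')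
  have eq: "(\<Sum>i\<in>UNIV. b (r.rfield (F i)) (r.rfield (F i))) q = (\<Sum>i\<in>UNIV. g (curvature A D (F i) Y Z) (F i) q)"
    if F: "orthonormal_frame_on A g V' F" "?W \<subseteq> V'" for V' and F :: "'n \<Rightarrow> 'm vfield"
  proof -
    have F': "vector_field_on A ?W (F i)" for i
      using F r.open_W by (auto simp: orthonormal_frame_on_def intro: vector_field_on_subset)
    show ?thesis
      using q W' by (simp add: b_def r.alg_R F' Y' Z' r.rfun_g r.curvature_field)
  qed
  show ?thesis
    using eq[OF E] eq[OF W'(2)] r.alg.trace_frame_independent[OF r.alg_frame[OF E] r.alg_frame[OF W'(2)] b]
    by (simp add: ricci_def)
qed

text \<open>The trace of the covariant differential of \<open>\<gamma>\<close>. Its linearity in the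
  second slot holds because the Leibniz terms of the derivative and of the connection
  cancel.\<close>

lemma codiff1_frame:
  assumes E: "orthonormal_frame_on A g W E" and \<gamma>: "one_form A \<gamma>" and q: "q \<in> W"
  shows "codiff1 A g D \<gamma> q = - (\<Sum>i\<in>UNIV. nabla1 D \<gamma> (E i) (E i) q)"
proof -
  obtain W' where W': "q \<in> W'" "orthonormal_frame_on A g W' (frame_near A g q)" by (rule frame_nearE)
  have o: "open W'" using W'(2) vector_field_on_open by (auto simp: orthonormal_frame_on_def)
  let ?W = "W \<inter> W'"
  interpret r: chart_region A g D ?W using o by (rule chart_region_Int)
  define c where "c X = r.rfun (\<gamma> X)" for X
  have c_fun: "c X \<in> funs_on ?W" if "X \<in> fields_on ?W" for X
    using one_form_smooth[OF \<gamma> fields_onD(1)[OF that]] by (simp add: c_def)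
  have c_add: "c (X + Y) = c X + c Y" if "X \<in> fields_on ?W" "Y \<in> fields_on ?W" for X Y
    using one_form_add[OF \<gamma> fields_onD(1)[OF that(1)] fields_onD(1)[OF that(2)]]
    by (intro r.fun_eqI) (auto simp: c_def)
  have c_scale: "c (vf_scale h X) = h * c X" if "h \<in> funs_on ?W" "X \<in> fields_on ?W" for h X
    using one_form_scale[OF \<gamma> funs_onD(1)[OF that(1)] fields_onD(1)[OF that(2)]]
    by (intro r.fun_eqI) (auto simp: c_def)
  define b where "b X Y = r.rfun (\<lambda>q. X q (c Y)) - c (r.rfield (D X Y))" for X Y
  have b: "r.alg.bilinear_form b"
    unfolding r.alg.bilinear_form_def b_def
    by (auto simp: c_fun c_add c_scale algebra_simps fun_eq_iff restrict_fun_def)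
  have eq: "(\<Sum>i\<in>UNIV. b (r.rfield (F i)) (r.rfield (F i))) q = (\<Sum>i\<in>UNIV. nabla1 D \<gamma> (F i) (F i) q)"
    if F: "orthonormal_frame_on A g V' F" "?W \<subseteq> V'" for V' and F :: "'n \<Rightarrow> 'm vfield"
  proof -
    have F': "vector_field_on A ?W (F i)" for i
      using F r.open_W by (auto simp: orthonormal_frame_on_def intro: vector_field_on_subset)
    have q': "q \<in> ?W" using q W' by simp
    have c_eq: "c (r.rfield X) = r.rfun (\<gamma> X)" if X: "vector_field_on A ?W X" for X
      unfolding c_def
      by (rule restrict_fun_cong, rule one_form_eq[OF \<gamma> vector_field_restrict[OF X]]) simp_all
    show ?thesis
      using q' vector_field_restrict_fun[OF F' q']
      by (simp add: b_def c_eq F' r.rfield_D connection_field nabla1_def)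
  qed
  show ?thesis
    using eq[OF E] eq[OF W'(2)] r.alg.trace_frame_independent[OF r.alg_frame[OF E] r.alg_frame[OF W'(2)] b]
    by (simp add: codiff1_def)
qed

text \<open>Metric compatibility says that passing to the dual field commutes with covariant
  differentiation.\<close>

lemma nabla1_dual:
  assumes Z: "vector_field_on A W Z"
    and dual: "\<And>Y q. vector_field_on A W Y \<Longrightarrow> q \<in> W \<Longrightarrow> \<theta> Y q = g Z Y q"
    and X: "vector_field_on A W X" and Y: "vector_field_on A W Y" and q: "q \<in> W"
  shows "nabla1 D \<theta> X Y q = g (D X Z) Y q"
proof -
  have "X q (\<theta> Y) = X q (g Z Y)"
    using vector_field_on_tangent[OF X q] open_W q by (rule tangent_vector_local) (rule dual[OF Y])
  then show ?thesis
    using metric_compatible[OF X Z Y q] by (simp add: nabla1_def dual connection_field X Y q)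
qed

text \<open>The dual field is the sum of the frame fields weighted by the values of
  \<open>\<gamma>\<close> on them.\<close>

lemma one_form_sharp:
  assumes E: "orthonormal_frame_on A g W E" and \<gamma>: "one_form A \<gamma>"
  obtains C where "C \<in> fields_on W"
    "\<And>X q. vector_field_on A W X \<Longrightarrow> q \<in> W \<Longrightarrow> \<gamma> X q = g C X q"
proof -
  have E': "vector_field_on A W (E i)" for i
    using E by (simp add: orthonormal_frame_on_def)
  define C where "C = (\<Sum>i\<in>UNIV. vf_scale (rfun (\<gamma> (E i))) (rfield (E i)))"
  have "C \<in> fields_on W"
    unfolding C_def by (intro alg.V_sum alg.V_scale restrict_fun_in restrict_field_in E' one_form_smooth[OF \<gamma>])
  moreover have "\<gamma> X q = g C X q" if X: "vector_field_on A W X" and q: "q \<in> W" for X q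
  proof -
    have "\<gamma> X q = \<gamma> (\<Sum>i\<in>UNIV. vf_scale (g X (E i)) (E i)) q"
      by (rule one_form_eq[OF \<gamma> X q]) (simp add: fun_eq_iff frame_expand[OF E X])
    also have "\<dots> = (\<Sum>i\<in>UNIV. g X (E i) q * \<gamma> (E i) q)"
      by (rule linear_on_sum[of q W \<gamma>])
         (auto intro: one_form_add[OF \<gamma>] one_form_scale[OF \<gamma>] simp: q open_W E' metric_smooth X)
    also have "\<dots> = (\<Sum>i\<in>UNIV. rfun (\<gamma> (E i)) q * g (rfield (E i)) X q)"
      by (simp add: q metric_local[OF E' X q] metric_sym[OF E' X q] mult.commute)
    also have "\<dots> = g C X q"
      unfolding C_def
      by (rule metric_sum[symmetric, of _ W])
         (simp_all add: smooth_restrict_fun one_form_smooth[OF \<gamma>] E' vector_field_restrict X q)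
    finally show ?thesis .
  qed
  ultimately show ?thesis using that by blast
qed

text \<open>Metric compatibility expands the derivative along \<open>Z\<close>, and torsion-freeness
  the brackets; the derivatives of \<open>X\<close> and \<open>Y\<close> along \<open>Z\<close>
  cancel.\<close>

lemma lie_deriv_metric:
  assumes "vector_field_on A W Z" "vector_field_on A W X" "vector_field_on A W Y" "q \<in> W"
  shows "lie_deriv A Z g X Y q = g (D X Z) Y q + g (D Y Z) X q"
proof -
  note v [simp] = assms
  have minus: "g (X - Y) Z q = g X Z q - g Y Z q"
    if "vector_field_on A W X" "vector_field_on A W Y" "vector_field_on A W Z" for X Y Z
    using metric_add[OF vector_field_on_minus[OF that(1,2)] that(2,3) assms(4)] by simp
  have bracket: "g (lie_bracket A Z X) Y q = g (D Z X) Y q - g (D X Z) Y q"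
    if "vector_field_on A W X" "vector_field_on A W Y" for X Y
    using metric_eq[OF lie_bracket_field[OF assms(1) that(1)] that(2) assms(4), of "D Z X - D X Z" Y]
    by (simp add: torsion_free[of W] that minus connection_field)
  have "g X (lie_bracket A Z Y) q = g (lie_bracket A Z Y) X q" "g X (D Z Y) q = g (D Z Y) X q"
    by (auto intro!: metric_sym[of W] simp: lie_bracket_field connection_field)
  then show ?thesis
    by (simp add: lie_deriv_def metric_compatible[OF v] bracket)
qed

text \<open>The algebraic identity \<open>lap_G_\<xi>\<close> read at \<open>p\<close> in the frame
  chosen there. The quantities needed at other points of \<open>W\<close> are made independent of
  the choice: Ricci and codifferential by the frame lemmas, the function to be differentiated by
  using \<open>\<gamma> \<xi>\<close>, which the first claim equates with the inner product.\<close>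

lemma bochner:
  assumes E: "orthonormal_frame_on A g W (frame_near A g p)" and p: "p \<in> W"
    and f: "smooth_fun_on A UNIV f" and grad: "is_gradient A g f \<xi>"
    and sol: "eta_ricci_soliton A g D \<xi> (extd0 f) lam \<mu>" and \<gamma>: "one_form A \<gamma>"
  shows "inner1 A g (extd0 f) \<gamma> p = \<gamma> \<xi> p"
    and "laplace0 A g D (\<gamma> \<xi>) p = inner1 A g (extd0 f) (laplace1 A g D \<gamma>) p
      + 2 * inner2 A g (hess D f) (nabla1 D \<gamma>) p - 2 * \<mu> * laplace0 A g D f p * \<gamma> \<xi> p"
proof -
  define E where "E = frame_near A g p"
  have frame: "orthonormal_frame_on A g W E" using assms(1) by (simp add: E_def)
  have E [simp]: "vector_field_on A W (E i)" for i
    using frame by (simp add: orthonormal_frame_on_def)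
  have \<xi> [simp]: "vector_field_on A W \<xi>"
    using grad open_W by (auto simp: is_gradient_def intro: vector_field_on_subset)
  have f_W [simp]: "smooth_fun_on A W f"
    using f open_W by (auto intro: smooth_fun_on_subset)
  have df: "X q f = g \<xi> X q" "extd0 f X q = g \<xi> X q" if "vector_field_on A W X" "q \<in> W" for X q
    using grad that by (auto simp: is_gradient_def extd0_def)
  obtain C where C_in [simp]: "C \<in> fields_on W"
    and C: "\<And>X q. vector_field_on A W X \<Longrightarrow> q \<in> W \<Longrightarrow> \<gamma> X q = g C X q"
    using one_form_sharp[OF frame \<gamma>] by metis
  have C_W [simp]: "vector_field_on A W C" by (rule fields_onD(1)[OF C_in])
  note simps [simp] = connection_field rfield_D_left rfield_D_right vector_field_restrict_fun p
    lie_bracket_field metric_local vector_field_restrict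

  interpret fr: levi_civita_frame "funs_on W" "fields_on W" "rfun (\<lambda>_. 1)" vf_scale
    "\<lambda>X h. rfun (\<lambda>q. X q h)" "\<lambda>X Y. rfield (D X Y)" "\<lambda>X Y. rfun (g X Y)" "\<lambda>i. rfield (E i)"
    by unfold_locales (rule alg_frame[OF frame order.refl])
  have const [simp]: "rfun (\<lambda>_. c) \<in> funs_on W" for c
    by (simp add: smooth_fun_on_const open_W)
  have act_const: "rfun (\<lambda>q. X q (rfun (\<lambda>_. c))) = 0" if "X \<in> fields_on W" for X c
    using tangent_vector_const[OF vector_field_on_tangent[OF fields_onD(1)[OF that]]] fields_onD(1)[OF that]
    by (intro fun_eqI) simp_all
  have act_f: "rfun (\<lambda>q. X q (rfun f)) = rfun (g (rfield \<xi>) X)" if "X \<in> fields_on W" for X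
    by (rule restrict_fun_cong) (simp add: fields_onD[OF that] df)
  \<comment> \<open>Taken from the plain algebraic locale, since it is needed to establish the
    soliton axiom itself: it makes the Lie derivative twice the Hessian.\<close>
  have hess_sym: "g (D X \<xi>) Y q = g (D Y \<xi>) X q"
    if "X \<in> fields_on W" "Y \<in> fields_on W" "q \<in> W" for X Y q
    using alg.gradient_hess_sym[of "rfield \<xi>" "rfun f" X Y] act_f that fields_onD(1)[of _ W]
    by (auto dest!: fun_cong[of _ _ q])
  interpret s: gradient_soliton "funs_on W" "fields_on W" "rfun (\<lambda>_. 1)" vf_scale
    "\<lambda>X h. rfun (\<lambda>q. X q h)" "\<lambda>X Y. rfield (D X Y)" "\<lambda>X Y. rfun (g X Y)" "\<lambda>i. rfield (E i)"
    "rfield \<xi>" "rfun f" "rfun (\<lambda>_. lam)" "rfun (\<lambda>_. \<mu>)"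
  proof (unfold_locales, goal_cases)
    case (8 X Y)
    then have XY [simp]: "vector_field_on A W X" "vector_field_on A W Y" by (simp_all add: fields_onD)
    show ?case
    proof (rule fun_eqI)
      fix q assume q [simp]: "q \<in> W"
      have "lie_deriv A \<xi> g X Y q + 2 * ricci A g D X Y q + 2 * lam * g X Y q
          + 2 * \<mu> * extd0 f X q * extd0 f Y q = 0"
        using sol XY q unfolding eta_ricci_soliton_def by blast
      moreover have "lie_deriv A \<xi> g X Y q = 2 * g (D X \<xi>) Y q"
        using hess_sym[OF 8 q] by (simp add: lie_deriv_metric)
      moreover have "fr.Ric X Y q = ricci A g D X Y q"
        unfolding ricci_frame[OF frame XY q] fr.Ric_def
        using 8 alg_R[OF E XY] by (simp add: curvature_field)
      ultimately show "(rfun (g (rfield (D X (rfield \<xi>))) Y) + fr.Ric X Y + rfun (\<lambda>_. lam) * rfun (g X Y) +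
         rfun (\<lambda>_. \<mu>) * (rfun (g (rfield \<xi>) X) * rfun (g (rfield \<xi>) Y))) q = 0 q"
        by (simp add: df algebra_simps)
    next
      fix q assume "q \<notin> W"
      moreover have "fr.Ric X Y \<in> funs_on W" using 8 by simp
      ultimately show "(rfun (g (rfield (D X (rfield \<xi>))) Y) + fr.Ric X Y + rfun (\<lambda>_. lam) * rfun (g X Y) +
         rfun (\<lambda>_. \<mu>) * (rfun (g (rfield \<xi>) X) * rfun (g (rfield \<xi>) Y))) q = 0 q"
        by (simp add: funs_onD)
    qed
  qed (simp_all add: act_const act_f)

  note hess = nabla1_dual[of \<xi> "extd0 f", OF \<xi> df(2)] and nabla_\<gamma> = nabla1_dual[of C \<gamma>, OF C_W C]
  show inner: "inner1 A g (extd0 f) \<gamma> p = \<gamma> \<xi> p"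
  proof -
    have "inner1 A g (extd0 f) \<gamma> p = (\<Sum>i\<in>UNIV. rfun (g (rfield \<xi>) (rfield (E i))) * rfun (g C (rfield (E i)))) p"
      by (simp add: inner1_def df C flip: E_def)
    also have "\<dots> = g \<xi> C p"
      by (subst fr.parseval) simp_all
    finally show ?thesis by (simp add: C metric_sym[of W])
  qed

  define k where "k = rfun (g (rfield \<xi>) C)"
  have u: "k q = \<gamma> \<xi> q" if "q \<in> W" for q
    using that by (simp add: k_def C metric_sym[of W \<xi>])
  have Xu: "X q k = X q (\<gamma> \<xi>)" if "vector_field_on A W X" "q \<in> W" for X q
    using vector_field_on_tangent[OF that] open_W that(2) by (rule tangent_vector_local) (rule u)
  have lap_u: "laplace0 A g D (\<gamma> \<xi>) p = fr.lap k p"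
  proof -
    have "E i p (\<lambda>q. E i q (\<gamma> \<xi>)) = E i p (\<lambda>q. rfield (E i) q k)" for i
      using vector_field_on_tangent[OF E p] open_W p by (rule tangent_vector_local) (simp add: Xu)
    moreover have "extd0 (\<gamma> \<xi>) X = (\<lambda>q. X q (\<gamma> \<xi>))" for X
      by (simp add: extd0_def fun_eq_iff)
    ultimately show ?thesis
      by (simp add: laplace0_def codiff1_def nabla1_def fr.lap_def Xu flip: E_def)
  qed
  have lap_f: "laplace0 A g D f p = fr.dvg (rfield \<xi>) p"
    by (simp add: laplace0_def codiff1_def fr.dvg_def hess flip: E_def)
  have inner2: "inner2 A g (hess D f) (nabla1 D \<gamma>) p
    = (\<Sum>i\<in>UNIV. \<Sum>j\<in>UNIV. rfun (g (rfield (D (rfield (E i)) (rfield \<xi>))) (rfield (E j)))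
        * rfun (g (rfield (D (rfield (E i)) C)) (rfield (E j)))) p"
    by (simp add: inner2_def hess_def hess nabla_\<gamma> flip: E_def)

  \<comment> \<open>An identity on all of \<open>W\<close>, where \<open>codiff1\<close> uses a
    different frame at each point; only so may it be differentiated at \<open>p\<close>.\<close>
  have codiff: "codiff1 A g D \<gamma> q = (- fr.dvg C) q" if "q \<in> W" for q
    using that by (simp add: codiff1_frame[OF frame \<gamma> that] fr.dvg_def nabla_\<gamma>)
  have extd: "extd1 A \<gamma> X Y q = fr.ext_d C (rfield X) (rfield Y) q"
    if [simp]: "vector_field_on A W X" "vector_field_on A W Y" "q \<in> W" for X Y q
  proof -
    have *: "X q (\<gamma> Y) = X q (g C Y)" if X: "vector_field_on A W X" and Y: "vector_field_on A W Y" for X Y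
      using vector_field_on_tangent[OF X \<open>q \<in> W\<close>] open_W \<open>q \<in> W\<close> by (rule tangent_vector_local) (rule C[OF Y])
    have **: "rfun (g C (rfield Z)) = rfun (g C Z)" if "vector_field_on A W Z" for Z
      using that by (intro restrict_fun_cong) simp
    show ?thesis
      by (simp add: extd1_def fr.ext_d_def * ** C rfield_lie_bracket)
  qed
  have laplace1: "laplace1 A g D \<gamma> X p = fr.hodge C (rfield X) p" if X [simp]: "vector_field_on A W X" for X
  proof -
    have "X p (codiff1 A g D \<gamma>) = X p (- fr.dvg C)"
      using vector_field_on_tangent[OF X p] open_W p by (rule tangent_vector_local) (rule codiff)
    also have "\<dots> = - X p (fr.dvg C)"
      using fun_cong[OF alg.act_uminus[of "rfield X" "fr.dvg C"], of p] by (simp del: alg.act_uminus)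
    finally have 1: "X p (codiff1 A g D \<gamma>) = - X p (fr.dvg C)" .
    have 2: "E i p (extd1 A \<gamma> (E i) X) = E i p (fr.ext_d C (rfield (E i)) (rfield X))" for i
      using vector_field_on_tangent[OF E p] open_W p by (rule tangent_vector_local) (simp add: extd)
    show ?thesis
      by (simp add: laplace1_def extd0_def 1 codiff2_def nabla2_def fr.hodge_def 2 extd flip: E_def)
  qed
  have inner_lap: "inner1 A g (extd0 f) (laplace1 A g D \<gamma>) p = fr.hodge C (rfield \<xi>) p"
    by (subst fr.hodge_expand) (simp_all add: inner1_def df laplace1 flip: E_def)

  show "laplace0 A g D (\<gamma> \<xi>) p = inner1 A g (extd0 f) (laplace1 A g D \<gamma>) p
      + 2 * inner2 A g (hess D f) (nabla1 D \<gamma>) p - 2 * \<mu> * laplace0 A g D f p * \<gamma> \<xi> p"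
    unfolding lap_u k_def lap_f inner2 inner_lap s.lap_G_\<xi>[OF C_in]
    by (simp add: C metric_sym[of W \<xi>])
qed

end

theorem proposition3p12:
  fixes A :: "('m::{t2_space,second_countable_topology}, 'n::finite) chart set"
    and g :: "'m tensor2"
    and nabla :: "'m connection"
    and f :: "'m \<Rightarrow> real"
    and \<xi> :: "'m vfield"
    and \<eta> \<gamma> :: "'m form1"
    and lam \<mu> :: real
  assumes "smooth_manifold A" and "CARD('n) > 2"
    and "riemannian_metric A g" and "levi_civita A g nabla"
    and "smooth_fun_on A UNIV f"
    and "is_gradient A g f \<xi>" and "\<eta> = extd0 f"
    and "eta_ricci_soliton A g nabla \<xi> \<eta> lam \<mu>"
    and "one_form A \<gamma>"
  shows "(orthogonal1 A g \<gamma> \<eta> \<longrightarrow>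
      (\<forall>p. inner2 A g (hess nabla f) (nabla1 nabla \<gamma>) p
         = - (1/2) * inner1 A g (extd0 f) (laplace1 A g nabla \<gamma>) p)) \<and>
    (harmonic1 A g nabla \<gamma> \<longrightarrow>
      (\<forall>p. (1/2) * laplace0 A g nabla (inner1 A g (extd0 f) \<gamma>) p
         = inner2 A g (hess nabla f) (nabla1 nabla \<gamma>) p
           - \<mu> * laplace0 A g nabla f p * inner1 A g (extd0 f) \<gamma> p) \<and>
      (harmonic0 A g nabla (inner1 A g (extd0 f) \<gamma>) \<longleftrightarrow>
        (\<forall>p. \<mu> * laplace0 A g nabla f p * inner1 A g (extd0 f) \<gamma> p
           = inner2 A g (hess nabla f) (nabla1 nabla \<gamma>) p)) \<and>
      (orthogonal1 A g \<gamma> \<eta> \<longrightarrow> orthogonal2 A g (nabla1 nabla \<gamma>) (nabla1 nabla \<eta>)))"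
proof -
  interpret riemannian_manifold A g nabla
    by unfold_locales fact+
  have bochner_everywhere: "inner1 A g (extd0 f) \<gamma> p = \<gamma> \<xi> p \<and>
      laplace0 A g nabla (\<gamma> \<xi>) p = inner1 A g (extd0 f) (laplace1 A g nabla \<gamma>) p
      + 2 * inner2 A g (hess nabla f) (nabla1 nabla \<gamma>) p - 2 * \<mu> * laplace0 A g nabla f p * \<gamma> \<xi> p" for p
  proof -
    obtain W where W: "p \<in> W" "orthonormal_frame_on A g W (frame_near A g p)" by (rule frame_nearE)
    obtain U \<phi> where c: "(U, \<phi>) \<in> A" "p \<in> U" by (rule chart_around)
    have o: "open (W \<inter> U)"
      using W(2) open_chart[OF c(1)] vector_field_on_open by (auto simp: orthonormal_frame_on_def)
    \<comment> \<open>The frame domain is shrunk into a chart; the frame itself stays the one used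
      in the definitions at \<open>p\<close>.\<close>
    interpret chart_region A g nabla "W \<inter> U"
      using c(1) o by unfold_locales auto
    have E: "orthonormal_frame_on A g (W \<inter> U) (frame_near A g p)"
      using W(2) vector_field_on_subset[OF _ o] by (auto simp: orthonormal_frame_on_def)
    have p: "p \<in> W \<inter> U" using W c by simp
    show ?thesis
      using bochner[OF E p assms(5,6) assms(8)[unfolded assms(7)] assms(9)] by blast
  qed
  have inner: "inner1 A g (extd0 f) \<gamma> = \<gamma> \<xi>"
    using bochner_everywhere by auto
  note B = bochner_everywhere[THEN conjunct2, folded inner]
  \<comment> \<open>Orthogonality at all points makes the inner product the zero function, so its
    Laplacian vanishes too.\<close>
  have orth: "inner1 A g (extd0 f) \<gamma> = (\<lambda>p. 0)" if "orthogonal1 A g \<gamma> \<eta>"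
    using that by (auto simp: orthogonal1_def inner1_def assms(7) mult.commute)
  have lap_zero: "laplace0 A g nabla (\<lambda>p. 0) p = 0" for p
  proof -
    obtain W where W: "p \<in> W" "orthonormal_frame_on A g W (frame_near A g p)" by (rule frame_nearE)
    have E: "vector_field_on A W (frame_near A g p i)" for i
      using W by (simp add: orthonormal_frame_on_def)
    have X0: "X q (\<lambda>p. 0) = 0" if "vector_field_on A W X" "q \<in> W" for X q
      by (rule tangent_vector_const[OF vector_field_on_tangent[OF that]])
    \<comment> \<open>The inner derivative is known to vanish only on the frame domain
      \<open>W\<close>, where the fields are tangent; locality replaces it by the zero
      function.\<close>
    have "frame_near A g p i p (extd0 (\<lambda>p. 0) (frame_near A g p i)) = frame_near A g p i p (\<lambda>p. 0)" for i
      using vector_field_on_tangent[OF E W(1)] vector_field_on_open[OF E] W(1)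
      by (rule tangent_vector_local) (simp add: extd0_def X0[OF E])
    then show ?thesis
      using W(1) by (simp add: laplace0_def codiff1_def nabla1_def X0[OF E] X0[OF connection_field[OF E E]])
        (simp add: extd0_def X0[OF connection_field[OF E E]])
  qed
  have part1: "inner2 A g (hess nabla f) (nabla1 nabla \<gamma>) p
      = - (1/2) * inner1 A g (extd0 f) (laplace1 A g nabla \<gamma>) p" if "orthogonal1 A g \<gamma> \<eta>" for p
    using B[of p] orth[OF that] by (simp add: lap_zero)
  have harmonic: "inner1 A g (extd0 f) (laplace1 A g nabla \<gamma>) p = 0" if "harmonic1 A g nabla \<gamma>" for p
  proof -
    obtain W where W: "p \<in> W" "orthonormal_frame_on A g W (frame_near A g p)" by (rule frame_nearE)
    \<comment> \<open>Harmonicity quantifies over fields on arbitrary open sets, so it applies to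
      the local frame fields.\<close>
    then have "laplace1 A g nabla \<gamma> (frame_near A g p i) p = 0" for i
      using that unfolding harmonic1_def orthonormal_frame_on_def by blast
    then show ?thesis by (simp add: inner1_def)
  qed
  have part2: "(1/2) * laplace0 A g nabla (inner1 A g (extd0 f) \<gamma>) p
         = inner2 A g (hess nabla f) (nabla1 nabla \<gamma>) p
           - \<mu> * laplace0 A g nabla f p * inner1 A g (extd0 f) \<gamma> p" if "harmonic1 A g nabla \<gamma>" for p
    using B[of p] harmonic[OF that, of p] by simp
  show ?thesis
  proof (intro conjI impI allI part1 part2)
    assume h: "harmonic1 A g nabla \<gamma>"
    have "laplace0 A g nabla (inner1 A g (extd0 f) \<gamma>) p = 0 \<longleftrightarrow>
        \<mu> * laplace0 A g nabla f p * inner1 A g (extd0 f) \<gamma> p = inner2 A g (hess nabla f) (nabla1 nabla \<gamma>) p" for p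
      using part2[OF h, of p] by auto
    then show "harmonic0 A g nabla (inner1 A g (extd0 f) \<gamma>) \<longleftrightarrow>
        (\<forall>p. \<mu> * laplace0 A g nabla f p * inner1 A g (extd0 f) \<gamma> p
           = inner2 A g (hess nabla f) (nabla1 nabla \<gamma>) p)"
      unfolding harmonic0_def by blast
    assume o: "orthogonal1 A g \<gamma> \<eta>"
    have "inner2 A g (nabla1 nabla \<gamma>) (nabla1 nabla \<eta>) p = 0" for p
    proof -
      have "inner2 A g (nabla1 nabla \<gamma>) (nabla1 nabla \<eta>) p = inner2 A g (hess nabla f) (nabla1 nabla \<gamma>) p"
        by (simp add: inner2_def hess_def assms(7) mult.commute)
      then show ?thesis using part1[OF o, of p] harmonic[OF h, of p] by simp
    qed
    then show "orthogonal2 A g (nabla1 nabla \<gamma>) (nabla1 nabla \<eta>)"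
      by (simp add: orthogonal2_def)
  qed
qed

end
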